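(* Call a sum $\Phi(x_1,\dots,x_u,y_1,\dots,y_v)=\sum_{i=1}^u \alpha_i x_i^2+\sum_{j=1}^v \beta_j(3y_j^2-2y_j)$ with $u,v\ge 0$ and positive integer coefficients $\alpha_i,\beta_j$ universal if for every nonnegative integer $N$ the equation $\Phi=N$ has a solution in integers. Among such sums with $u+v=3$ (counted up to reordering the $\alpha_i$ among themselves and the $\beta_j$ among themselves), there are exactly $6$ universal ones, namely $$x^2+y^2+P_8(z),\quad x^2+y^2+2P_8(z),\quad x^2+3y^2+P_8(z),\quad x^2+P_8(y)+P_8(z),\quad 2x^2+3y^2+P_8(z),\quad 2x^2+P_8(y)+P_8(z),$$ where $P_8(t)=3t^2-2t$.
   Context: For an integer $m\ge3$, a generalized $m$-gonal number is an integer of the form $P_m(x)=\frac{(m-2)x^2-(m-4)x}{2}$ with $x\in\mathbb{Z}$; thus $P_4(x)=x^2$ and $P_8(x)=3x^2-2x$. A mixed sum of generalized $4$- and $8$-gonal numbers is $\alpha_1P_4(x_1)+\cdots+\alpha_uP_4(x_u)+\beta_1P_8(y_1)+\cdots+\beta_vP_8(y_v)$ with positive integers $\alpha_i,\beta_j$; it is called $n$-ary (ternary for $n=3$) when $u+v=n$. *)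

theory Defs
  imports Complex_Main "HOL-Library.Multiset"
begin

definition gen_polygonal :: "int \<Rightarrow> int \<Rightarrow> int" where
  "gen_polygonal m x = ((m - 2) * x\<^sup>2 - (m - 4) * x) div 2"

text \<open>The division by 2 above is exact.\<close>

lemma two_times_gen_polygonal: "2 * gen_polygonal m x = (m - 2) * x\<^sup>2 - (m - 4) * x"
proof -
  have "even ((m - 2) * x\<^sup>2 - (m - 4) * x)" by simp
  then show ?thesis unfolding gen_polygonal_def by simp
qed

lemma gen_polygonal_4: "gen_polygonal 4 x = x\<^sup>2"
  using two_times_gen_polygonal[of 4 x] by simp

lemma gen_polygonal_8: "gen_polygonal 8 x = 3 * x\<^sup>2 - 2 * x"
  using two_times_gen_polygonal[of 8 x] by simp

text \<open>
  A mixed sum is given by the lists of its coefficients: \<open>\<alpha>\<close> for the 4-gonal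
  part and \<open>\<beta>\<close> for the 8-gonal part. Either list may be empty.
\<close>

definition mixed_sum :: "int list \<Rightarrow> int list \<Rightarrow> int list \<Rightarrow> int list \<Rightarrow> int" where
  "mixed_sum \<alpha> \<beta> x y =
     (\<Sum>i<length \<alpha>. \<alpha> ! i * gen_polygonal 4 (x ! i)) +
     (\<Sum>j<length \<beta>. \<beta> ! j * gen_polygonal 8 (y ! j))"

definition ternary_coeffs :: "int list \<Rightarrow> int list \<Rightarrow> bool" where
  "ternary_coeffs \<alpha> \<beta> \<longleftrightarrow>
     (\<forall>a\<in>set \<alpha>. 0 < a) \<and> (\<forall>b\<in>set \<beta>. 0 < b) \<and> length \<alpha> + length \<beta> = 3"

definition universal :: "int list \<Rightarrow> int list \<Rightarrow> bool" where
  "universal \<alpha> \<beta> \<longleftrightarrow>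
     (\<forall>N\<ge>0. \<exists>x y. length x = length \<alpha> \<and> length y = length \<beta> \<and> mixed_sum \<alpha> \<beta> x y = N)"

end

theory Submission
  imports Defs "HOL-Number_Theory.Number_Theory" "HOL-Library.Discrete_Functions"
    "HOL-Computational_Algebra.Squarefree"
begin

text \<open>
  Since \<open>3 (3 y\<^sup>2 - 2 y) + 1 = (3 y - 1)\<^sup>2\<close>, universality of each of the six sums follows from
  representing suitable integers by \<open>x\<^sup>2 + y\<^sup>2 + 3 z\<^sup>2\<close> or \<open>x\<^sup>2 + y\<^sup>2 + 6 z\<^sup>2\<close>, and the second form
  represents \<open>n\<close> whenever the first represents \<open>2 n\<close>. To represent a squarefree \<open>n\<close> by the first form,
  take a prime \<open>p \<equiv> 5 (mod 8)\<close> with \<open>(p/q) = (-3/q)\<close> for the odd primes \<open>q\<close> dividing \<open>n\<close>.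
  Then Legendre's theorem, proved by the pigeonhole principle, solves \<open>p x\<^sup>2 + 3 y\<^sup>2 = n t\<^sup>2\<close>
  (or \<open>x\<^sup>2 + 3 p y\<^sup>2 = (n/3) t\<^sup>2\<close> if 3 divides \<open>n\<close>), and \<open>p\<close> is a sum of two squares, so \<open>n\<close> is
  represented rationally. A Davenport--Cassels descent for \<open>x\<^sup>2 + u\<^sup>2 + u v + v\<^sup>2\<close>, for which every
  rational point is at distance less than 1 from a lattice point, gives an integral representation.

  Only quadratic conditions are imposed on \<open>p\<close>, so real characters suffice for its existence:
  by Mertens' argument \<open>\<Sum> \<chi>(d) \<Lambda>(d) / d\<close> stays bounded for a nonprincipal \<open>\<chi>\<close> as \<open>L(1, \<chi>) \<noteq> 0\<close>.
  The latter is Monsky's argument: if \<open>L(1, \<chi>) = 0\<close>, the series \<open>\<Sum> \<chi>(n) t\<^sup>n / (1 - t\<^sup>n)\<close> would be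
  bounded for \<open>t < 1\<close>, but its power series coefficients \<open>\<Sum>\<^bsub>d | n\<^esub> \<chi>(d)\<close> are nonnegative, and at
  least 1 at squares.

  Conversely, a universal sum represents 1 to 18, which bounds its coefficients by 5 and leaves a
  finite check.
\<close>

section \<open>Summation by parts and interchange of divisor sums\<close>

text \<open>Summation by parts moves the differences to the weight \<open>f\<close>, where they
  telescope. The sums starting at \<open>a\<close> are differences of two partial sums, whence the
  factor 2.\<close>

lemma abel_summation_bound:
  fixes c f :: "nat \<Rightarrow> real"
  assumes partial: "\<And>n. \<bar>\<Sum>k<n. c k\<bar> \<le> C"
    and anti: "\<And>k. a \<le> k \<Longrightarrow> f (Suc k) \<le> f k"
    and nonneg: "\<And>k. a \<le> k \<Longrightarrow> 0 \<le> f k"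
    and "a \<le> b"
  shows "\<bar>\<Sum>k=a..<b. c k * f k\<bar> \<le> 2 * C * f a"
proof -
  define S where "S n = (\<Sum>k=a..<n. c k)" for n
  have S_bound: "\<bar>S n\<bar> \<le> 2 * C" if "a \<le> n" for n
  proof -
    have "S n = (\<Sum>k<n. c k) - (\<Sum>k<a. c k)"
      unfolding S_def using sum_diff_nat_ivl[of 0 a n c] that by (simp add: lessThan_atLeast0)
    then show ?thesis using partial[of n] partial[of a] by linarith
  qed
  have "(\<Sum>k=a..<b. c k * f k) = S b * f b + (\<Sum>k=a..<b. S (Suc k) * (f k - f (Suc k)))"
    using \<open>a \<le> b\<close>
  proof (induction b rule: dec_induct)
    case base
    then show ?case by (simp add: S_def)
  next
    case (step b)
    then have "S (Suc b) = S b + c b" by (simp add: S_def)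
    with step show ?case by (simp add: algebra_simps)
  qed
  also have "\<bar>\<dots>\<bar> \<le> \<bar>S b * f b\<bar> + (\<Sum>k=a..<b. \<bar>S (Suc k) * (f k - f (Suc k))\<bar>)"
    by (intro order_trans[OF abs_triangle_ineq] add_left_mono sum_abs)
  also have "\<dots> \<le> 2 * C * f b + (\<Sum>k=a..<b. 2 * C * (f k - f (Suc k)))"
  proof (intro add_mono sum_mono)
    show "\<bar>S b * f b\<bar> \<le> 2 * C * f b"
      using S_bound[OF \<open>a \<le> b\<close>] nonneg[OF \<open>a \<le> b\<close>] by (simp add: abs_mult mult_right_mono)
  next
    fix k assume "k \<in> {a..<b}"
    then have "a \<le> k" by simp
    then show "\<bar>S (Suc k) * (f k - f (Suc k))\<bar> \<le> 2 * C * (f k - f (Suc k))"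
      using S_bound[of "Suc k"] anti[of k] by (simp add: abs_mult mult_right_mono)
  qed
  also have "(\<Sum>k=a..<b. 2 * C * (f k - f (Suc k))) = 2 * C * (f a - f b)"
    using \<open>a \<le> b\<close> by (induction b rule: dec_induct) (auto simp: algebra_simps)
  finally show ?thesis by (simp add: algebra_simps)
qed

text \<open>Each factorization n = d k is counted once on either side: by its product n first, or by
  d first with k up to \<open>x div d\<close>.\<close>

lemma sum_dvd_swap:
  fixes g :: "nat \<Rightarrow> nat \<Rightarrow> 'a::comm_monoid_add"
  shows "(\<Sum>n=1..x. \<Sum>d | d dvd n. g d (n div d)) = (\<Sum>d=1..x. \<Sum>k=1..x div d. g d k)"
proof -
  have "(\<Sum>n=1..x. \<Sum>d | d dvd n. g d (n div d))
      = (\<Sum>(n, d)\<in>(SIGMA n:{1..x}. {d. d dvd n}). g d (n div d))"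
    by (subst sum.Sigma) auto
  also have "\<dots> = (\<Sum>(d, k)\<in>(SIGMA d:{1..x}. {1..x div d}). g d k)"
    by (rule sum.reindex_bij_witness[where i = "\<lambda>(d, k). (d * k, d)" and j = "\<lambda>(n, d). (d, n div d)"])
       (auto simp: Suc_le_eq div_le_mono less_eq_div_iff_mult_less_eq mult.commute
             intro: order_trans[OF dvd_imp_le[OF dvd_triv_left]] order_trans[OF dvd_imp_le] dvd_pos_nat)
  also have "\<dots> = (\<Sum>d=1..x. \<Sum>k=1..x div d. g d k)"
    by (subst sum.Sigma) auto
  finally show ?thesis .
qed

subsection \<open>Chebyshev's bound\<close>

text \<open>The logarithm of each of 1, ..., n splits into \<open>mangoldt\<close> values over its
  divisors, and d divides exactly \<open>n div d\<close> of these numbers.\<close>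

lemma ln_fact_eq_sum_mangoldt:
  "ln (fact n) = (\<Sum>d=1..n. mangoldt d * real (n div d))"
proof -
  have "ln (fact n) = (\<Sum>k=1..n. ln (real k))"
    by (subst fact_prod, subst of_nat_prod, subst ln_prod) auto
  also have "\<dots> = (\<Sum>k=1..n. \<Sum>d | d dvd k. mangoldt d)"
    by (intro sum.cong refl) (use mangoldt_sum[where 'a = real] in auto)
  also have "\<dots> = (\<Sum>d=1..n. mangoldt d * real (n div d))"
    by (subst sum_dvd_swap[where g = "\<lambda>d k. mangoldt d"]) (simp add: mult.commute)
  finally show ?thesis .
qed

text \<open>Chebyshev's trick: the weight \<open>2 * n div d - 2 * (n div d)\<close> equals 1 for n
  < d <= 2 n and is nonnegative for all d, and the sum weighted in this way is the logarithm of the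
  central binomial coefficient, at most 2 n ln 2.\<close>

lemma sum_mangoldt_double:
  "(\<Sum>d=1..2 * n. mangoldt d) \<le> (\<Sum>d=1..n. mangoldt d) + 2 * real n"
proof -
  have "(\<Sum>d=1..2 * n. mangoldt d) - (\<Sum>d=1..n. mangoldt d) = (\<Sum>d=n+1..2*n. mangoldt d :: real)"
    using sum.ub_add_nat[of 1 n "mangoldt :: nat \<Rightarrow> real" n] by (simp add: mult_2)
  also have "\<dots> = (\<Sum>d=n+1..2*n. mangoldt d * (real (2 * n div d) - 2 * real (n div d)))"
  proof (intro sum.cong refl)
    fix d assume d: "d \<in> {n+1..2*n}"
    then have "2 * n div d = 1" by (intro div_nat_eqI) auto
    then show "mangoldt d = mangoldt d * (real (2 * n div d) - 2 * real (n div d))"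
      using d by simp
  qed
  also have "\<dots> \<le> (\<Sum>d=1..2*n. mangoldt d * (real (2 * n div d) - 2 * real (n div d)))"
  proof (intro sum_mono2)
    fix d :: nat
    have "2 * (n div d) \<le> 2 * n div d"
      by (metis div_mult1_eq le_add1 mult.commute)
    then show "0 \<le> mangoldt d * (real (2 * n div d) - 2 * real (n div d))"
      by (intro mult_nonneg_nonneg mangoldt_nonneg) linarith
  qed auto
  also have "\<dots> = ln (fact (2 * n)) - 2 * (\<Sum>d=1..2*n. mangoldt d * real (n div d))"
    unfolding ln_fact_eq_sum_mangoldt by (simp add: algebra_simps sum_subtractf sum_distrib_left)
  also have "(\<Sum>d=1..2*n. mangoldt d * real (n div d)) = ln (fact n)"
    unfolding ln_fact_eq_sum_mangoldt by (intro sum.mono_neutral_right) auto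
  also have "ln (fact (2 * n)) - 2 * ln (fact n) = ln (real (2 * n choose n))"
  proof -
    have "fact n * fact n * real (2 * n choose n) = fact (2 * n)"
      using binomial_fact_lemma[of n "2 * n"]
      by (metis diff_add_inverse2 le_add2 mult_2 of_nat_fact of_nat_mult)
    then have "ln (fact (2 * n)) = ln (fact n * fact n * real (2 * n choose n))" by simp
    then show ?thesis by (simp add: ln_mult)
  qed
  also have "\<dots> \<le> ln (2 ^ (2 * n))"
  proof (subst ln_le_cancel_iff)
    have "2 * n choose n \<le> 2 ^ (2 * n)"
      by (rule binomial_le_pow2)
    then show "real (2 * n choose n) \<le> 2 ^ (2 * n)"
      by (metis of_nat_le_iff of_nat_numeral of_nat_power)
  qed auto
  also have "\<dots> = 2 * real n * ln 2" by (simp add: ln_realpow)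
  also have "\<dots> \<le> 2 * real n * 1"
    by (intro mult_left_mono) (use ln_2_less_1 in auto)
  finally show ?thesis by simp
qed

lemma sum_mangoldt_le: "(\<Sum>d=1..n. mangoldt d) \<le> 4 * real n"
proof (induction n rule: less_induct)
  case (less n)
  show ?case
  proof (cases "n \<le> 1")
    case True
    then have "n = 0 \<or> n = 1" by auto
    then show ?thesis by auto
  next
    case False
    define m where "m = (n + 1) div 2"
    have m: "m < n" "n \<le> 2 * m" "2 * m \<le> n + 1" using False by (auto simp: m_def)
    have "(\<Sum>d=1..n. mangoldt d :: real) \<le> (\<Sum>d=1..2 * m. mangoldt d)"
      by (intro sum_mono2) (use m mangoldt_nonneg in auto)
    also have "\<dots> \<le> (\<Sum>d=1..m. mangoldt d) + 2 * real m" by (rule sum_mangoldt_double)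
    also have "\<dots> \<le> 6 * real m" using less[OF m(1)] by simp
    \<comment> \<open>6 m = 2 (2 m) + 2 m <= 2 (n + 1) + 2 (n - 1) = 4 n.\<close>
    also have "\<dots> \<le> 4 * real n" using m False by linarith
    finally show ?thesis .
  qed
qed

text \<open>Two estimates of ln n! are compared: the expansion by \<open>mangoldt\<close>, where
  \<open>n div d\<close> is at most n / d, and n! >= (n / e)^n, which comes from a single term of
  the series of exp n.\<close>

lemma sum_mangoldt_div_ge: "(\<Sum>d=1..n. mangoldt d / real d) \<ge> ln (real n) - 1"
proof (cases "n = 0")
  case False
  have "real n ^ n / fact n \<le> exp (real n)"
  proof -
    have "(\<Sum>k\<in>{n}. real n ^ k / fact k) \<le> exp (real n)"
      unfolding exp_def using summable_exp[of "real n"]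
      by (intro sum_le_suminf[THEN order_trans]) (auto simp: field_simps scaleR_conv_of_real)
    then show ?thesis by simp
  qed
  then have "ln (real n ^ n / fact n) \<le> real n"
    using False by (subst ln_exp[symmetric], subst ln_le_cancel_iff) auto
  then have "real n * ln (real n) - real n \<le> ln (fact n)"
    using False by (simp add: ln_div ln_realpow)
  also have "ln (fact n) \<le> (\<Sum>d=1..n. mangoldt d * (real n / real d))"
    unfolding ln_fact_eq_sum_mangoldt
    by (intro sum_mono mult_left_mono mangoldt_nonneg) (simp add: of_nat_div_le_of_nat)
  also have "\<dots> = real n * (\<Sum>d=1..n. mangoldt d / real d)"
    by (simp add: sum_distrib_left mult_ac)
  finally have "real n * (ln (real n) - 1) \<le> real n * (\<Sum>d=1..n. mangoldt d / real d)"
    by (simp add: algebra_simps)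
  then show ?thesis using False by simp
qed simp

text \<open>The function ln x / x decreases from e on, and 3 is the first integer beyond: k (ln (k +
  1) - ln k) <= 1 <= ln k.\<close>

lemma ln_div_antimono: "3 \<le> k \<Longrightarrow> ln (real (Suc k)) / real (Suc k) \<le> ln (real k) / real k"
proof -
  assume k: "3 \<le> k"
  have "ln (real (Suc k)) - ln (real k) = ln (1 + 1 / real k)"
  proof -
    have "1 + 1 / real k = real (Suc k) / real k" using k by (simp add: field_simps)
    then show ?thesis using k by (simp add: ln_div del: of_nat_Suc)
  qed
  also have "\<dots> \<le> 1 / real k" using k by (intro ln_add_one_self_le_self) auto
  finally have "real k * (ln (real (Suc k)) - ln (real k)) \<le> 1" using k by (simp add: field_simps)
  also have "1 \<le> ln (real k)"
    using k exp_le by (subst ln_ge_iff) auto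
  finally show ?thesis using k by (simp add: field_simps)
qed

subsection \<open>Real characters\<close>

text \<open>Zeros are not tied to the integers sharing a factor with \<open>m\<close>, so a
  character remains one for every multiple of its modulus. This puts characters of different moduli
  over a common one.\<close>

locale real_character =
  fixes \<chi> :: "nat \<Rightarrow> real" and m :: nat
  assumes char_mult: "\<chi> (a * b) = \<chi> a * \<chi> b"
    and char_range: "\<chi> a \<in> {-1, 0, 1}"
    and char_1: "\<chi> 1 = 1"
    and char_periodic: "\<chi> (a + m) = \<chi> a"
    and modulus_pos: "0 < m"
begin

lemma abs_char_le_1: "\<bar>\<chi> a\<bar> \<le> 1"
  using char_range[of a] by auto

lemma char_power: "\<chi> (a ^ k) = \<chi> a ^ k"
  by (induction k) (use char_1 char_mult in auto)

text \<open>The Dirichlet convolution of \<open>\<chi>\<close> with the constant 1, i.e. the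
  coefficients of zeta(s) L(s, chi).\<close>

definition divisor_char_sum :: "nat \<Rightarrow> real" where
  "divisor_char_sum n = (\<Sum>d | d dvd n. \<chi> d)"

text \<open>A divisor of p^k n is uniquely p^i d with i <= k and d dividing n, and multiplicativity
  of \<open>\<chi>\<close> separates the two factors.\<close>

lemma divisor_char_sum_prime_power_mult:
  assumes "prime p" "\<not> p dvd n" "n > 0"
  shows "divisor_char_sum (p ^ k * n) = (\<Sum>i\<le>k. \<chi> p ^ i) * divisor_char_sum n"
proof -
  have "p > 0" using assms(1) prime_gt_0_nat by blast
  have "bij_betw (\<lambda>(i, d). p ^ i * d) ({..k} \<times> {d. d dvd n}) {d. d dvd p ^ k * n}"
    unfolding bij_betw_def
  proof
    show "inj_on (\<lambda>(i, d). p ^ i * d) ({..k} \<times> {d. d dvd n})"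
    proof (rule inj_onI; clarify)
      fix i d j e
      assume d: "d dvd n" and e: "e dvd n" and eq: "p ^ i * d = p ^ j * e"
      have "\<not> p dvd d" "\<not> p dvd e" using d e assms(2) dvd_trans by blast+
      then have "multiplicity p (p ^ i * d) = i" "multiplicity p (p ^ j * e) = j"
        using \<open>p > 0\<close> by (auto intro!: multiplicity_eqI simp: mult.commute[of p])
      with eq have "i = j" by simp
      with eq \<open>p > 0\<close> show "i = j \<and> d = e" by simp
    qed
    show "(\<lambda>(i, d). p ^ i * d) ` ({..k} \<times> {d. d dvd n}) = {d. d dvd p ^ k * n}"
    proof (intro equalityI subsetI; clarify)
      fix i d assume "i \<le> k" "d dvd n"
      then show "p ^ i * d dvd p ^ k * n" by (intro mult_dvd_mono le_imp_power_dvd)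
    next
      fix d assume "d dvd p ^ k * n"
      then obtain a b where ab: "d = a * b" "a dvd p ^ k" "b dvd n"
        using division_decomp by blast
      then obtain i where "i \<le> k" "a = p ^ i"
        using divides_primepow_nat assms(1) by blast
      then have "(i, b) \<in> {..k} \<times> {d. d dvd n}" "d = (case (i, b) of (i, d) \<Rightarrow> p ^ i * d)"
        using ab by auto
      then show "d \<in> (\<lambda>(i, d). p ^ i * d) ` ({..k} \<times> {d. d dvd n})" by blast
    qed
  qed
  from sum.reindex_bij_betw[OF this, of \<chi>, symmetric]
  have "divisor_char_sum (p ^ k * n) = (\<Sum>(i, d)\<in>{..k} \<times> {d. d dvd n}. \<chi> p ^ i * \<chi> d)"
    by (simp add: divisor_char_sum_def case_prod_unfold char_mult char_power)
  also have "\<dots> = (\<Sum>i\<le>k. \<chi> p ^ i) * divisor_char_sum n"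
    by (simp add: divisor_char_sum_def sum_product sum.cartesian_product)
  finally show ?thesis .
qed

text \<open>For \<open>\<chi> p\<close> equal to 1, 0 or -1 the sum is k + 1, or 1 (from the term
  0^0), or alternately 1 and 0.\<close>

lemma char_power_sum_nonneg: "0 \<le> (\<Sum>i\<le>k. \<chi> p ^ i)"
  and char_power_sum_even: "even k \<Longrightarrow> 1 \<le> (\<Sum>i\<le>k. \<chi> p ^ i)"
proof -
  have minus_1: "(\<Sum>i\<le>k. (-1) ^ i :: real) = (if even k then 1 else 0)"
    by (induction k) auto
  have zero: "(\<Sum>i\<le>k. 0 ^ i :: real) = 1"
    by (induction k) auto
  show "0 \<le> (\<Sum>i\<le>k. \<chi> p ^ i)" "even k \<Longrightarrow> 1 \<le> (\<Sum>i\<le>k. \<chi> p ^ i)"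
    using char_range[of p] minus_1 zero by auto
qed

text \<open>Stripping the full power of a prime off n reduces both claims to sums of powers of
  \<open>\<chi> p\<close>; in the square the exponent is even, which gives the bound 1.\<close>

lemma divisor_char_sum_lower_bounds:
  "n > 0 \<Longrightarrow> 0 \<le> divisor_char_sum n \<and> 1 \<le> divisor_char_sum (n\<^sup>2)"
proof (induction n rule: less_induct)
  case (less n)
  have sum_1: "divisor_char_sum 1 = 1" using char_1 by (simp add: divisor_char_sum_def)
  consider "n = 1" | "n > 1" using less.prems by linarith
  then show ?case
  proof cases
    case 1
    then show ?thesis using sum_1 by simp
  next
    case 2
    then obtain p where p: "prime p" "p dvd n" using prime_factor_nat[of n] by auto
    define k where "k = multiplicity p n"
    obtain n' where n': "n = p ^ k * n'" "\<not> p dvd n'"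
      using multiplicity_decompose'[of n p] p less.prems k_def
      by (metis not_prime_unit not_gr_zero)
    have "n' > 0" using less.prems n' by (auto intro: Nat.gr0I)
    have "k > 0" using p less.prems by (simp add: k_def prime_multiplicity_gt_zero_iff)
    then have "p ^ k > 1" by (intro one_less_power prime_gt_1_nat p)
    then have "n' < n" using n' \<open>n' > 0\<close> by simp
    note IH = less.IH[OF this \<open>n' > 0\<close>]
    have "\<not> p dvd n'\<^sup>2" using n'(2) p(1) prime_dvd_power by blast
    moreover have "n\<^sup>2 = p ^ (2 * k) * n'\<^sup>2"
      using n'(1) by (simp add: power_mult_distrib power_mult[symmetric] mult.commute)
    ultimately have "divisor_char_sum (n\<^sup>2) = (\<Sum>i\<le>2 * k. \<chi> p ^ i) * divisor_char_sum (n'\<^sup>2)"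
      using divisor_char_sum_prime_power_mult[OF p(1), of "n'\<^sup>2"] \<open>n' > 0\<close> by simp
    moreover have "1 * 1 \<le> (\<Sum>i\<le>2 * k. \<chi> p ^ i) * divisor_char_sum (n'\<^sup>2)"
      using char_power_sum_even[of "2 * k" p] IH by (intro mult_mono) auto
    moreover have "divisor_char_sum n = (\<Sum>i\<le>k. \<chi> p ^ i) * divisor_char_sum n'"
      using divisor_char_sum_prime_power_mult[OF p(1) n'(2) \<open>n' > 0\<close>] n'(1) by metis
    ultimately show ?thesis using char_power_sum_nonneg IH by simp
  qed
qed

end

locale nonprincipal_real_character = real_character +
  assumes period_sum: "(\<Sum>a<m. \<chi> a) = 0"
begin

text \<open>Whole periods sum to 0, and fewer than m terms remain.\<close>

lemma partial_sum_bound: "\<bar>\<Sum>k<n. \<chi> k\<bar> \<le> real m"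
proof (induction n rule: less_induct)
  case (less n)
  show ?case
  proof (cases "n < m")
    case True
    have "\<bar>\<Sum>k<n. \<chi> k\<bar> \<le> (\<Sum>k<n. 1)"
      by (intro order_trans[OF sum_abs] sum_mono abs_char_le_1)
    then show ?thesis using True by simp
  next
    case False
    then have "(\<Sum>k<n. \<chi> k) = (\<Sum>k<m. \<chi> k) + (\<Sum>k=m..<n. \<chi> k)"
      by (simp add: lessThan_atLeast0 sum.atLeastLessThan_concat)
    also have "(\<Sum>k=m..<n. \<chi> k) = (\<Sum>k<n - m. \<chi> (k + m))"
      using sum.shift_bounds_nat_ivl[of \<chi> 0 m "n - m"] False by (simp add: lessThan_atLeast0)
    finally have "(\<Sum>k<n. \<chi> k) = (\<Sum>k<n - m. \<chi> k)"
      by (simp add: period_sum char_periodic)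
    then show ?thesis using less[of "n - m"] False modulus_pos by simp
  qed
qed

lemmas char_abel_bound = abel_summation_bound[OF partial_sum_bound]

text \<open>The explicit rate of convergence to L(1, chi) is what the later estimates use; it is the
  Abel bound for the tails.\<close>

lemma harmonic_sum_limit:
  obtains L where "\<And>n. \<bar>(\<Sum>k=1..n. \<chi> k / real k) - L\<bar> \<le> 2 * real m / real (Suc n)"
proof -
  define s where "s n = (\<Sum>k=1..n. \<chi> k / real k)" for n
  have bound: "\<bar>s n' - s n\<bar> \<le> 2 * real m / real (Suc n)" if "n \<le> n'" for n n'
  proof -
    have "s n' - s n = (\<Sum>k=Suc n..<Suc n'. \<chi> k * (1 / real k))"
      using that sum.atLeastLessThan_concat[of 1 "Suc n" "Suc n'" "\<lambda>k. \<chi> k / real k"]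
      by (simp add: s_def flip: atLeastLessThanSuc_atLeastAtMost)
    then show ?thesis
      using char_abel_bound[of "Suc n" "\<lambda>k. 1 / real k" "Suc n'"] that
      by (simp add: frac_le)
  qed
  have "Cauchy s"
  proof (rule CauchyI')
    fix e :: real assume "e > 0"
    obtain M where M: "2 * real m / e < real M" using reals_Archimedean2 by blast
    show "\<exists>M. \<forall>i\<ge>M. \<forall>j>i. dist (s i) (s j) < e"
    proof (intro exI[of _ M] allI impI)
      fix i j assume "M \<le> i" "i < j"
      then have "dist (s i) (s j) \<le> 2 * real m / real (Suc i)"
        using bound[of i j] by (simp add: dist_real_def abs_minus_commute)
      also have "\<dots> < e"
      proof -
        have "2 * real m < e * real M" using M \<open>e > 0\<close> by (simp add: field_simps)
        also have "\<dots> \<le> e * real (Suc i)" using \<open>M \<le> i\<close> \<open>e > 0\<close> by simp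
        finally show ?thesis by (simp add: field_simps)
      qed
      finally show "dist (s i) (s j) < e" .
    qed
  qed
  then obtain L where L: "s \<longlonglongrightarrow> L" using Cauchy_convergent convergent_def by blast
  show ?thesis
  proof (rule that)
    fix n
    have "(\<lambda>n'. \<bar>s n' - s n\<bar>) \<longlonglongrightarrow> \<bar>L - s n\<bar>" by (intro tendsto_intros L)
    then have "\<bar>L - s n\<bar> \<le> 2 * real m / real (Suc n)"
      by (rule LIMSEQ_le_const2) (use bound in blast)
    then show "\<bar>(\<Sum>k=1..n. \<chi> k / real k) - L\<bar> \<le> 2 * real m / real (Suc n)"
      by (simp add: s_def abs_minus_commute)
  qed
qed

lemma log_sum_bounded:
  obtains B where "\<And>n. \<bar>\<Sum>k=1..n. \<chi> k * ln (real k) / real k\<bar> \<le> B"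
proof -
  define f where "f k = ln (real k) / real k" for k :: nat
  \<comment> \<open>The weight ln k / k decreases only from 3 on, so the terms for k = 1, 2 are
    bounded separately.\<close>
  define B where "B = (\<Sum>k=1..<3. \<bar>\<chi> k * f k\<bar>) + 2 * real m * f 3"
  have "\<bar>\<Sum>k=1..n. \<chi> k * f k\<bar> \<le> B" for n
  proof (cases "n < 3")
    case True
    have "\<bar>\<Sum>k=1..n. \<chi> k * f k\<bar> \<le> (\<Sum>k=1..n. \<bar>\<chi> k * f k\<bar>)" by (rule sum_abs)
    also have "\<dots> \<le> (\<Sum>k=1..<3. \<bar>\<chi> k * f k\<bar>)"
      using True by (intro sum_mono2) auto
    also have "\<dots> \<le> B" by (simp add: B_def f_def)
    finally show ?thesis .
  next
    case False
    then have "(\<Sum>k=1..n. \<chi> k * f k) = (\<Sum>k=1..<3. \<chi> k * f k) + (\<Sum>k=3..<Suc n. \<chi> k * f k)"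
      by (simp add: sum.atLeastLessThan_concat atLeastLessThanSuc_atLeastAtMost[symmetric])
    moreover have "\<bar>\<Sum>k=1..<3. \<chi> k * f k\<bar> \<le> (\<Sum>k=1..<3. \<bar>\<chi> k * f k\<bar>)" by (rule sum_abs)
    moreover have "\<bar>\<Sum>k=3..<Suc n. \<chi> k * f k\<bar> \<le> 2 * real m * f 3"
      using False ln_div_antimono by (intro char_abel_bound) (auto simp: f_def)
    ultimately show ?thesis unfolding B_def by linarith
  qed
  then show ?thesis using that[of B] by (simp add: f_def)
qed

end

subsection \<open>Nonvanishing at 1\<close>

text \<open>The inequality of arithmetic and geometric means, by pairing the exponents i and n - 1 -
  i. With s as square root of the base, the geometric mean has the integral exponent n - 1.\<close>

lemma am_gm_geometric_sum:
  fixes s :: real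
  assumes "0 \<le> s"
  shows "real n * s ^ (n - 1) \<le> (\<Sum>i<n. (s\<^sup>2) ^ i)"
proof -
  have "2 * (\<Sum>i<n. (s\<^sup>2) ^ i) = (\<Sum>i<n. (s\<^sup>2) ^ i) + (\<Sum>i<n. (s\<^sup>2) ^ (n - Suc i))"
    by (subst sum.nat_diff_reindex) simp
  also have "\<dots> = (\<Sum>i<n. (s ^ i)\<^sup>2 + (s ^ (n - Suc i))\<^sup>2)"
    by (simp add: sum.distrib power_mult[symmetric] mult.commute)
  also have "\<dots> \<ge> (\<Sum>i<n. 2 * s ^ (n - 1))"
  proof (intro sum_mono)
    fix i assume "i \<in> {..<n}"
    then have "s ^ (n - 1) = s ^ i * s ^ (n - Suc i)" by (simp flip: power_add)
    then show "2 * s ^ (n - 1) \<le> (s ^ i)\<^sup>2 + (s ^ (n - Suc i))\<^sup>2"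
      using sum_squares_bound[of "s ^ i" "s ^ (n - Suc i)"] by simp
  qed
  finally show ?thesis by simp
qed

text \<open>The term t^n / (1 - t^n) of the Lambert series behaves like 1 / (n (1 - t)) as t tends
  to 1. The difference of the two decreases in n from the value 1, so its sum against
  \<open>\<chi>\<close> is bounded uniformly in t.\<close>

definition monsky_weight :: "real \<Rightarrow> nat \<Rightarrow> real" where
  "monsky_weight t n = 1 / (real n * (1 - t)) - t ^ n / (1 - t ^ n)"

context
  fixes t :: real
  assumes t: "0 < t" "t < 1"
begin

private definition geom :: "nat \<Rightarrow> real" where "geom n = (\<Sum>i<n. t ^ i)"

private lemma geom_pos: "0 < n \<Longrightarrow> 0 < geom n"
  unfolding geom_def using t by (intro sum_pos) auto

private lemma monsky_weight_eq:
  "monsky_weight t n = (1 / real n - t ^ n / geom n) / (1 - t)"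
  using t by (simp add: monsky_weight_def geom_def one_diff_power_eq diff_divide_distrib mult.commute)

lemma monsky_weight_nonneg:
  assumes "0 < n" shows "0 \<le> monsky_weight t n"
proof -
  have "(\<Sum>i<n. t ^ n) \<le> geom n"
    unfolding geom_def using t by (intro sum_mono power_decreasing) auto
  then have "t ^ n / geom n \<le> 1 / real n"
    using assms geom_pos[OF assms] by (simp add: field_simps)
  then show ?thesis using t by (simp add: monsky_weight_eq)
qed

text \<open>Up to the factor 1 / (1 - t), the step from n to n + 1 lowers the weight by 1 / (n (n +
  1)) - t^n / (\<open>geom n\<close> \<open>geom (Suc n)\<close>). The mean inequality for both
  geometric sums makes this nonnegative.\<close>

lemma monsky_weight_antimono:
  assumes "0 < n" shows "monsky_weight t (Suc n) \<le> monsky_weight t n"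
proof -
  define s where "s = sqrt t"
  have s: "0 < s" "s < 1" "s\<^sup>2 = t" using t by (auto simp: s_def)
  have geom_ge: "real k * s ^ (k - 1) \<le> geom k" for k
    using am_gm_geometric_sum[of s k] s by (simp add: geom_def)
  have pos: "0 < geom n" "0 < geom (Suc n)" using geom_pos assms by auto
  have "real n * (real n + 1) * t ^ n \<le> real n * (real n + 1) * (s ^ (n - 1) * s ^ n)"
  proof (intro mult_left_mono)
    have "t ^ n = s ^ (2 * n)" using s by (simp add: power_mult)
    also have "\<dots> \<le> s ^ (n - 1 + n)" using s by (intro power_decreasing) auto
    finally show "t ^ n \<le> s ^ (n - 1) * s ^ n" by (simp add: power_add)
  qed simp
  also have "\<dots> = (real n * s ^ (n - 1)) * (real (Suc n) * s ^ (Suc n - 1))"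
    by (simp add: algebra_simps)
  also have "\<dots> \<le> geom n * geom (Suc n)"
    using geom_ge pos s by (intro mult_mono geom_ge) auto
  finally have "t ^ n / (geom n * geom (Suc n)) \<le> 1 / (real n * (real n + 1))"
    using pos assms by (simp add: divide_simps mult.commute)
  moreover have "t ^ n / geom n - t ^ Suc n / geom (Suc n) = t ^ n / (geom n * geom (Suc n))"
  proof -
    have "geom (Suc n) = 1 + t * geom n"
      unfolding geom_def by (subst sum.lessThan_Suc_shift) (simp add: sum_distrib_left)
    then have "geom (Suc n) - t * geom n = 1" by simp
    moreover have "t ^ n / geom n - t ^ Suc n / geom (Suc n)
        = t ^ n * (geom (Suc n) - t * geom n) / (geom n * geom (Suc n))"
      using pos by (simp add: field_simps)
    ultimately show ?thesis by simp
  qed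
  moreover have "1 / real n - 1 / real (Suc n) = 1 / (real n * (real n + 1))"
    using assms by (simp add: field_simps)
  ultimately have "1 / real (Suc n) - t ^ Suc n / geom (Suc n) \<le> 1 / real n - t ^ n / geom n"
    by linarith
  then show ?thesis unfolding monsky_weight_eq using t by (intro divide_right_mono) auto
qed

lemma monsky_weight_1: "monsky_weight t 1 = 1"
  using t by (simp add: monsky_weight_def flip: diff_divide_distrib)

end

context nonprincipal_real_character
begin

text \<open>The hypothesis \<open>L\<close> is what L(1, chi) = 0 gives for the partial sums. With t
  fixed, the part divided by 1 - t vanishes as n grows, which leaves the bound
  \<open>2 * real m\<close>.\<close>

lemma lambert_partial_sum_le:
  assumes t: "0 < t" "t < 1" and L: "\<bar>\<Sum>k=1..n. \<chi> k / real k\<bar> \<le> 2 * real m / real (Suc n)"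
  shows "(\<Sum>k=1..n. divisor_char_sum k * t ^ k)
       \<le> 2 * real m + (2 * real m / real (Suc n) + real n * t ^ n) / (1 - t)"
proof -
  have pow_less: "t ^ d < 1" if "0 < d" for d using t that by (simp add: power_less_one_iff)
  have "(\<Sum>k=1..n. divisor_char_sum k * t ^ k)
      = (\<Sum>k=1..n. \<Sum>d | d dvd k. \<chi> d * (t ^ d) ^ (k div d))"
    unfolding divisor_char_sum_def sum_distrib_right
    by (intro sum.cong refl) (simp flip: power_mult)
  also have "\<dots> = (\<Sum>d=1..n. \<Sum>k=1..n div d. \<chi> d * (t ^ d) ^ k)" by (rule sum_dvd_swap)
  \<comment> \<open>Cutting the geometric series of t^d at q = \<open>n div d\<close> costs at most
    t^n / (1 - t), as the first omitted exponent d (q + 1) is at least n.\<close>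
  also have "\<dots> \<le> (\<Sum>d=1..n. \<chi> d * (t ^ d / (1 - t ^ d)) + t ^ n / (1 - t))"
  proof (intro sum_mono)
    fix d assume d: "d \<in> {1..n}"
    define q where "q = n div d"
    have "n \<le> d * Suc q"
      using d dividend_less_div_times[of d n] by (simp add: q_def algebra_simps)
    have less: "t ^ d < 1" using d pow_less by simp
    have "(1 - x) * (\<Sum>k=1..q. x ^ k) = x - x ^ Suc q" for x :: real
    proof (induction q)
      case (Suc q)
      have "(1 - x) * (\<Sum>k=1..Suc q. x ^ k) = (1 - x) * (\<Sum>k=1..q. x ^ k) + (1 - x) * x ^ Suc q"
        by (simp add: distrib_left)
      also have "\<dots> = x - x ^ Suc (Suc q)" unfolding Suc by (simp add: algebra_simps)
      finally show ?case .
    qed simp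
    from this[of "t ^ d"] have "(\<Sum>k=1..q. (t ^ d) ^ k) = (t ^ d - (t ^ d) ^ Suc q) / (1 - t ^ d)"
      using less by (simp add: field_simps)
    then have "\<chi> d * (\<Sum>k=1..q. (t ^ d) ^ k)
        = \<chi> d * (t ^ d / (1 - t ^ d)) + - \<chi> d * (t ^ (d * Suc q) / (1 - t ^ d))"
      by (simp only: power_mult diff_divide_distrib) (simp add: algebra_simps)
    also have "- \<chi> d * (t ^ (d * Suc q) / (1 - t ^ d)) \<le> 1 * (t ^ n / (1 - t))"
    proof (intro mult_mono frac_le)
      show "- \<chi> d \<le> 1" using abs_char_le_1[of d] by linarith
      show "t ^ (d * Suc q) \<le> t ^ n" using t \<open>n \<le> d * Suc q\<close> by (intro power_decreasing) auto
      show "1 - t \<le> 1 - t ^ d" using d t power_decreasing[of 1 d t] by simp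
    qed (use t less in auto)
    finally show "(\<Sum>k=1..n div d. \<chi> d * (t ^ d) ^ k) \<le> \<chi> d * (t ^ d / (1 - t ^ d)) + t ^ n / (1 - t)"
      by (simp add: q_def sum_distrib_left)
  qed
  \<comment> \<open>The Lambert term is 1 / (d (1 - t)) minus \<open>monsky_weight t d\<close>; the
    first part is controlled by \<open>L\<close>, the second by Abel summation.\<close>
  also have "\<dots> = (\<Sum>d=1..n. \<chi> d / real d) / (1 - t)
      + - (\<Sum>d=1..n. \<chi> d * monsky_weight t d) + real n * t ^ n / (1 - t)"
    by (simp add: sum.distrib monsky_weight_def algebra_simps sum_subtractf sum_divide_distrib)
  also have "(\<Sum>d=1..n. \<chi> d / real d) / (1 - t) \<le> (2 * real m / real (Suc n)) / (1 - t)"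
    using L t by (intro divide_right_mono) auto
  also have "- (\<Sum>d=1..n. \<chi> d * monsky_weight t d) \<le> 2 * real m * monsky_weight t 1"
  proof -
    have "\<bar>\<Sum>d=1..<Suc n. \<chi> d * monsky_weight t d\<bar> \<le> 2 * real m * monsky_weight t 1"
      using monsky_weight_antimono[OF t] monsky_weight_nonneg[OF t]
      by (intro char_abel_bound) auto
    then show ?thesis by (simp only: atLeastLessThanSuc_atLeastAtMost)
  qed
  finally show ?thesis using t monsky_weight_1[OF t] by (simp add: add_divide_distrib)
qed

text \<open>Only the K positive squares up to K^2 are kept, where the coefficients are at least 1;
  the other terms are nonnegative.\<close>

lemma divisor_char_sum_generating_ge:
  assumes t: "0 < t" "t < 1" and "K\<^sup>2 \<le> n"
  shows "real K * t ^ K\<^sup>2 \<le> (\<Sum>k=1..n. divisor_char_sum k * t ^ k)"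
proof -
  have "real K * t ^ K\<^sup>2 = (\<Sum>j=1..K. t ^ K\<^sup>2)" by simp
  also have "\<dots> \<le> (\<Sum>j=1..K. divisor_char_sum (j\<^sup>2) * t ^ (j\<^sup>2))"
  proof (intro sum_mono)
    fix j assume j: "j \<in> {1..K}"
    then have "t ^ K\<^sup>2 \<le> t ^ (j\<^sup>2)" using t by (intro power_decreasing power_mono) auto
    also have "\<dots> \<le> divisor_char_sum (j\<^sup>2) * t ^ (j\<^sup>2)"
      using divisor_char_sum_lower_bounds[of j] j t by (simp add: mult_right_mono)
    finally show "t ^ K\<^sup>2 \<le> divisor_char_sum (j\<^sup>2) * t ^ (j\<^sup>2)" .
  qed
  also have "\<dots> = (\<Sum>k\<in>(\<lambda>j. j\<^sup>2) ` {1..K}. divisor_char_sum k * t ^ k)"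
    by (subst sum.reindex) (auto simp: inj_on_def)
  also have "\<dots> \<le> (\<Sum>k=1..n. divisor_char_sum k * t ^ k)"
  proof (intro sum_mono2)
    have "j\<^sup>2 \<le> n" if "j \<le> K" for j
      using power_mono[OF that, of 2] \<open>K\<^sup>2 \<le> n\<close> by linarith
    then show "(\<lambda>j. j\<^sup>2) ` {1..K} \<subseteq> {1..n}" by (auto simp: Suc_le_eq)
  next
    fix k assume "k \<in> {1..n} - (\<lambda>j. j\<^sup>2) ` {1..K}"
    then show "0 \<le> divisor_char_sum k * t ^ k"
      using divisor_char_sum_lower_bounds[of k] t by auto
  qed auto
  finally show ?thesis .
qed

lemma harmonic_limit_nonzero:
  assumes "\<And>n. \<bar>(\<Sum>k=1..n. \<chi> k / real k) - L\<bar> \<le> 2 * real m / real (Suc n)"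
  shows "L \<noteq> 0"
proof
  assume "L = 0"
  with assms have L: "\<bar>\<Sum>k=1..n. \<chi> k / real k\<bar> \<le> 2 * real m / real (Suc n)" for n by simp
  \<comment> \<open>One more than the bound 2 m that survives when first n tends to infinity and
    then t tends to 1.\<close>
  define K where "K = 2 * m + 1"
  have le: "real K * t ^ K\<^sup>2 \<le> 2 * real m" if t: "0 < t" "t < 1" for t :: real
  proof (rule LIMSEQ_le_const)
    have "(\<lambda>n. 2 * real m / real (Suc n)) \<longlonglongrightarrow> 0"
      by (rule LIMSEQ_Suc[OF lim_const_over_n])
    moreover have "(\<lambda>n. real n * t ^ n) \<longlonglongrightarrow> 0"
      using powser_times_n_limit_0[of t] t by simp
    ultimately have "(\<lambda>n. 2 * real m + (2 * real m / real (Suc n) + real n * t ^ n) / (1 - t))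
        \<longlonglongrightarrow> 2 * real m + (0 + 0) / (1 - t)"
      using t by (intro tendsto_intros) auto
    then show "(\<lambda>n. 2 * real m + (2 * real m / real (Suc n) + real n * t ^ n) / (1 - t))
        \<longlonglongrightarrow> 2 * real m" by simp
    show "\<exists>N. \<forall>n\<ge>N. real K * t ^ K\<^sup>2 \<le> 2 * real m + (2 * real m / real (Suc n) + real n * t ^ n) / (1 - t)"
      using divisor_char_sum_generating_ge[OF t] lambert_partial_sum_le[OF t L]
      by (meson order_trans)
  qed
  have "((\<lambda>t::real. real K * t ^ K\<^sup>2) \<longlongrightarrow> real K * 1 ^ K\<^sup>2) (at_left 1)"
    by (intro tendsto_intros)
  moreover have "eventually (\<lambda>t::real. real K * t ^ K\<^sup>2 \<le> 2 * real m) (at_left 1)"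
    by (rule eventually_mono[OF eventually_at_left_real[of 0 1]]) (use le in auto)
  ultimately have "real K * 1 ^ K\<^sup>2 \<le> 2 * real m"
    by (intro tendsto_upperbound) auto
  then show False by (simp add: K_def)
qed

subsection \<open>Mertens' estimate\<close>

text \<open>Writing ln as a divisor sum of \<open>mangoldt\<close> turns the bounded sum of chi(k)
  ln k / k into the sum of chi(d) \<open>mangoldt d\<close> / d times the partial sums of L(1, chi)
  up to \<open>n div d\<close>. Replacing these by L has bounded cost by Chebyshev's bound, and L is
  not 0.\<close>

lemma mertens_bounded:
  obtains B where "\<And>n. \<bar>\<Sum>d=1..n. \<chi> d * mangoldt d / real d\<bar> \<le> B"
proof -
  obtain L where L: "\<bar>(\<Sum>k=1..n. \<chi> k / real k) - L\<bar> \<le> 2 * real m / real (Suc n)" for n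
    using harmonic_sum_limit by blast
  obtain B where B: "\<bar>\<Sum>k=1..n. \<chi> k * ln (real k) / real k\<bar> \<le> B" for n
    using log_sum_bounded by blast
  have "L \<noteq> 0" using harmonic_limit_nonzero L by blast
  define P where "P n = (\<Sum>d=1..n. \<chi> d * mangoldt d / real d)" for n
  have "\<bar>P n\<bar> \<le> (B + 8 * real m) / \<bar>L\<bar>" for n
  proof -
    define S where "S q = (\<Sum>k=1..q. \<chi> k / real k)" for q
    have "(\<Sum>k=1..n. \<chi> k * ln (real k) / real k)
        = (\<Sum>k=1..n. \<Sum>d | d dvd k. \<chi> d * mangoldt d / real d * (\<chi> (k div d) / real (k div d)))"
    proof (intro sum.cong refl)
      fix k assume k: "k \<in> {1..n}"
      have "\<chi> k * ln (real k) / real k = (\<Sum>d | d dvd k. \<chi> k * mangoldt d / real k)"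
        using mangoldt_sum[of k, where 'a = real] k
        by (simp flip: sum_distrib_left sum_divide_distrib)
      also have "\<dots> = (\<Sum>d | d dvd k. \<chi> d * mangoldt d / real d * (\<chi> (k div d) / real (k div d)))"
      proof (intro sum.cong refl)
        fix d assume "d \<in> {d. d dvd k}"
        then obtain e where "k = d * e" by auto
        with k show "\<chi> k * mangoldt d / real k
            = \<chi> d * mangoldt d / real d * (\<chi> (k div d) / real (k div d))"
          by (auto simp: char_mult)
      qed
      finally show "\<chi> k * ln (real k) / real k
          = (\<Sum>d | d dvd k. \<chi> d * mangoldt d / real d * (\<chi> (k div d) / real (k div d)))" .
    qed
    also have "\<dots> = (\<Sum>d=1..n. \<chi> d * mangoldt d / real d * S (n div d))"
      by (subst sum_dvd_swap) (simp add: S_def sum_distrib_left)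
    finally have eq: "(\<Sum>k=1..n. \<chi> k * ln (real k) / real k)
        = (\<Sum>d=1..n. \<chi> d * mangoldt d / real d * S (n div d))" .
    have "\<bar>L * P n - (\<Sum>k=1..n. \<chi> k * ln (real k) / real k)\<bar>
        = \<bar>\<Sum>d=1..n. \<chi> d * mangoldt d / real d * (L - S (n div d))\<bar>"
      unfolding eq by (simp add: P_def sum_distrib_left algebra_simps sum_subtractf diff_divide_distrib)
    also have "\<dots> \<le> (\<Sum>d=1..n. \<bar>\<chi> d * mangoldt d / real d * (L - S (n div d))\<bar>)"
      by (rule sum_abs)
    also have "\<dots> \<le> (\<Sum>d=1..n. mangoldt d * (2 * real m / real n))"
    proof (intro sum_mono)
      fix d assume d: "d \<in> {1..n}"
      \<comment> \<open>This makes the error at \<open>n div d\<close>, divided by d, at most 2 m /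
        n for every d.\<close>
      have "n < d * Suc (n div d)"
        using d dividend_less_div_times[of d n] by (simp add: algebra_simps)
      then have "real n \<le> real (d * Suc (n div d))"
        unfolding of_nat_le_iff by simp
      then have "2 * real m / (real d * real (Suc (n div d))) \<le> 2 * real m / real n"
        using d by (intro divide_left_mono) (auto simp: distrib_left)
      moreover have "\<bar>L - S (n div d)\<bar> \<le> 2 * real m / real (Suc (n div d))"
        using L[of "n div d"] by (simp add: S_def abs_minus_commute)
      then have "\<bar>L - S (n div d)\<bar> / real d \<le> 2 * real m / real (Suc (n div d)) / real d"
        by (rule divide_right_mono) simp
      ultimately have *: "\<bar>L - S (n div d)\<bar> / real d \<le> 2 * real m / real n"
        by (simp add: mult.commute)
      have "\<bar>\<chi> d * mangoldt d / real d * (L - S (n div d))\<bar>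
          = \<bar>\<chi> d\<bar> * mangoldt d * (\<bar>L - S (n div d)\<bar> / real d)"
        by (simp add: abs_mult)
      also have "\<dots> \<le> 1 * mangoldt d * (2 * real m / real n)"
        using * abs_char_le_1[of d] mangoldt_nonneg
        by (intro mult_mono) auto
      finally show "\<bar>\<chi> d * mangoldt d / real d * (L - S (n div d))\<bar> \<le> mangoldt d * (2 * real m / real n)"
        by simp
    qed
    also have "\<dots> = (\<Sum>d=1..n. mangoldt d) * (2 * real m / real n)"
      by (rule sum_distrib_right[symmetric])
    also have "\<dots> \<le> 4 * real n * (2 * real m / real n)"
      by (intro mult_right_mono sum_mangoldt_le) auto
    also have "\<dots> \<le> 8 * real m" by simp
    finally have "\<bar>L * P n\<bar> \<le> B + 8 * real m" using B[of n] by linarith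
    then show ?thesis using \<open>L \<noteq> 0\<close> by (simp add: abs_mult field_simps)
  qed
  then show ?thesis using that[of "(B + 8 * real m) / \<bar>L\<bar>"] by (simp only: P_def)
qed

end

subsection \<open>Primes with prescribed character values\<close>

text \<open>Only powers p^k of primes dividing m contribute, and for each such p the sum of 1 / p^k
  is at most 1. The exponents stay below n because k < p^k <= n.\<close>

lemma sum_mangoldt_not_coprime_le:
  assumes "m > 0"
  shows "(\<Sum>d | d \<in> {1..n} \<and> \<not> coprime d m. mangoldt d / real d) \<le> (\<Sum>p\<in>prime_factors m. ln (real p))"
proof -
  let ?g = "\<lambda>(p, k). ln (real p) / real (p ^ k)"
  let ?A = "{d \<in> {1..n}. \<not> coprime d m \<and> primepow d}"
  have "(\<Sum>d | d \<in> {1..n} \<and> \<not> coprime d m. mangoldt d / real d) = (\<Sum>d\<in>?A. mangoldt d / real d)"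
    by (rule sum.mono_neutral_right) (auto simp: mangoldt_def)
  also have "\<dots> \<le> (\<Sum>x\<in>prime_factors m \<times> {1..n}. ?g x)"
  proof (rule sum_le_included)
    show "\<forall>d\<in>?A. \<exists>x\<in>prime_factors m \<times> {1..n}. (case x of (p, k) \<Rightarrow> p ^ k) = d
        \<and> mangoldt d / real d \<le> ?g x"
    proof
      fix d assume d: "d \<in> ?A"
      then obtain p k where pk: "prime p" "k > 0" "d = p ^ k" unfolding primepow_def by blast
      have "p dvd m"
        using d pk by (metis (mono_tags, lifting) mem_Collect_eq coprime_power_left_iff prime_imp_coprime)
      then have "p \<in> prime_factors m" using pk assms by (simp add: prime_factors_dvd)
      moreover have "k < p ^ k" using pk(1) by (intro power_gt_expt prime_gt_Suc_0_nat)
      then have "k \<in> {1..n}" using d pk by auto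
      moreover have "mangoldt d / real d = ?g (p, k)" using pk by simp
      ultimately show "\<exists>x\<in>prime_factors m \<times> {1..n}. (case x of (p, k) \<Rightarrow> p ^ k) = d
          \<and> mangoldt d / real d \<le> ?g x"
        using pk by (intro bexI[of _ "(p, k)"]) auto
    qed
    have "0 \<le> ln (real p)" if "p \<in> prime_factors m" for p
      using prime_ge_1_nat[OF in_prime_factors_imp_prime[OF that]] by simp
    then show "\<forall>x\<in>prime_factors m \<times> {1..n}. 0 \<le> ?g x" by auto
  qed auto
  also have "\<dots> = (\<Sum>p\<in>prime_factors m. \<Sum>k=1..n. ln (real p) / real (p ^ k))"
    by (simp add: sum.cartesian_product)
  also have "\<dots> \<le> (\<Sum>p\<in>prime_factors m. ln (real p))"
  proof (intro sum_mono)
    fix p assume "p \<in> prime_factors m"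
    then have p: "2 \<le> p" by (simp add: in_prime_factors_imp_prime prime_ge_2_nat)
    have "(\<Sum>k=1..n. ln (real p) / real (p ^ k)) = ln (real p) * (\<Sum>k=1..n. 1 / real p ^ k)"
      by (simp add: sum_distrib_left)
    also have "\<dots> \<le> ln (real p) * (\<Sum>k=1..n. (1 / 2) ^ k)"
      using p by (intro mult_left_mono sum_mono)
        (auto simp: power_one_over intro!: frac_le power_mono)
    also have "(\<Sum>k=1..n. (1 / 2 :: real) ^ k) = 1 - (1 / 2) ^ n"
      by (induction n) auto
    also have "ln (real p) * (1 - (1 / 2) ^ n) \<le> ln (real p) * 1"
      using p by (intro mult_left_mono) auto
    finally show "(\<Sum>k=1..n. ln (real p) / real (p ^ k)) \<le> ln (real p)" by simp
  qed
  finally show ?thesis .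
qed

text \<open>Multiplication by \<open>a\<close> permutes the residues modulo m, so the sum over a
  period equals its own negative.\<close>

lemma nonprincipalI:
  assumes "real_character \<chi> m" "coprime a m" "\<chi> a = -1"
  shows "nonprincipal_real_character \<chi> m"
proof -
  interpret real_character \<chi> m by fact
  have mod: "\<chi> (n mod m) = \<chi> n" for n
  proof (induction n rule: less_induct)
    case (less n)
    show ?case
    proof (cases "n < m")
      case False
      then have "\<chi> ((n - m) mod m) = \<chi> (n - m)" using less[of "n - m"] modulus_pos by simp
      then show ?thesis using False char_periodic[of "n - m"] by (simp add: le_mod_geq)
    qed simp
  qed
  have "bij_betw (\<lambda>b. (a * b) mod m) {..<m} {..<m}"
    unfolding bij_betw_def
  proof
    show inj: "inj_on (\<lambda>b. (a * b) mod m) {..<m}"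
    proof (rule inj_onI)
      fix b c assume "b \<in> {..<m}" "c \<in> {..<m}" "a * b mod m = a * c mod m"
      moreover from this(3) have "[b = c] (mod m)"
        using assms(2) by (simp add: cong_def[symmetric] cong_mult_lcancel_nat)
      ultimately show "b = c" by (simp add: cong_def)
    qed
    have "(\<lambda>b. (a * b) mod m) ` {..<m} \<subseteq> {..<m}" using modulus_pos by auto
    then show "(\<lambda>b. (a * b) mod m) ` {..<m} = {..<m}"
      using inj by (intro card_subset_eq) (auto simp: card_image)
  qed
  from sum.reindex_bij_betw[OF this, of \<chi>]
  have "(\<Sum>b<m. \<chi> b) = \<chi> a * (\<Sum>b<m. \<chi> b)"
    by (simp add: mod char_mult sum_distrib_left)
  then have "(\<Sum>b<m. \<chi> b) = 0" using assms(3) by simp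
  then show ?thesis by unfold_locales
qed

text \<open>
  The hypothesis that some prescribed value is \<open>-1\<close> makes every prime power with the prescribed
  values an odd power, so that its base has the same values; prime powers need no separate estimate.
\<close>

theorem prime_with_prescribed_character_values:
  fixes \<chi> :: "'i \<Rightarrow> nat \<Rightarrow> real" and \<epsilon> :: "'i \<Rightarrow> real"
  assumes "finite I" "m > 0"
    and char: "\<And>i. i \<in> I \<Longrightarrow> real_character (\<chi> i) m"
    and nonzero: "\<And>i n. i \<in> I \<Longrightarrow> coprime n m \<Longrightarrow> \<chi> i n \<noteq> 0"
    and sign: "\<And>i. i \<in> I \<Longrightarrow> \<epsilon> i \<in> {-1, 1}"
    and indep: "\<And>i. i \<in> I \<Longrightarrow> \<exists>a. coprime a m \<and> \<chi> i a = -1 \<and> (\<forall>j\<in>I - {i}. \<chi> j a = 1)"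
    and negative: "i0 \<in> I" "\<epsilon> i0 = -1"
  obtains p where "prime p" "\<not> p dvd m" "\<And>i. i \<in> I \<Longrightarrow> \<chi> i p = \<epsilon> i"
proof -
  \<comment> \<open>Products of the given characters. For nonempty \<open>S\<close> a witness from
    \<open>indep\<close> for a member of \<open>S\<close> has value -1, so \<open>\<psi> S\<close>
    is nonprincipal; the empty set gives the principal character modulo m.\<close>
  define \<psi> where "\<psi> S n = (if coprime n m then \<Prod>i\<in>S. \<chi> i n else 0)" for S n
  \<comment> \<open>For n coprime to m each factor is 0 or 2, so \<open>F n\<close> is nonzero
    exactly when all \<open>\<chi> i n\<close> equal \<open>\<epsilon> i\<close>.\<close>
  define F where "F n = (if coprime n m then \<Prod>i\<in>I. \<epsilon> i * \<chi> i n + 1 else 0)" for n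
  have F_eq: "F n = (\<Sum>S\<in>Pow I. (\<Prod>i\<in>S. \<epsilon> i) * \<psi> S n)" for n
    by (simp add: F_def \<psi>_def prod_add[OF \<open>finite I\<close>] prod.distrib)
  have range: "\<chi> i n \<in> {-1, 1}" if "i \<in> I" "coprime n m" for i n
    using real_character.char_range[OF char[OF that(1)], of n] nonzero[OF that] by auto
  have nonprincipal: "nonprincipal_real_character (\<psi> S) m" if S: "S \<subseteq> I" "S \<noteq> {}" for S
  proof -
    have SI: "i \<in> I" if "i \<in> S" for i using S that by blast
    have char_\<psi>: "real_character (\<psi> S) m"
    proof
      fix a b :: nat
      show "\<psi> S (a * b) = \<psi> S a * \<psi> S b"
        using real_character.char_mult[OF char[OF SI]] by (simp add: \<psi>_def prod.distrib)
      have "(\<Prod>i\<in>S. \<chi> i a) \<in> {-1, 1}" if "coprime a m"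
        using finite_subset[OF S(1) \<open>finite I\<close>] S(1)
        by (induction S rule: finite_induct) (use range[OF _ that] in force)+
      then show "\<psi> S a \<in> {-1, 0, 1}" by (auto simp: \<psi>_def)
      show "\<psi> S 1 = 1"
        using real_character.char_1[OF char[OF SI]] by (simp add: \<psi>_def)
      have "coprime (a + m) m \<longleftrightarrow> coprime a m"
        unfolding coprime_iff_gcd_eq_1 by simp
      then show "\<psi> S (a + m) = \<psi> S a"
        using real_character.char_periodic[OF char[OF SI]] by (simp add: \<psi>_def)
    qed fact
    obtain i where i: "i \<in> S" using S by blast
    obtain a where a: "coprime a m" "\<chi> i a = -1" "\<forall>j\<in>I - {i}. \<chi> j a = 1"
      using indep[OF SI[OF i]] by blast
    have "(\<Prod>j\<in>S. \<chi> j a) = \<chi> i a * (\<Prod>j\<in>S - {i}. \<chi> j a)"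
      using i finite_subset[OF S(1) \<open>finite I\<close>] by (simp add: prod.remove)
    also have "(\<Prod>j\<in>S - {i}. \<chi> j a) = 1"
      using a S by (intro prod.neutral) auto
    finally have "\<psi> S a = -1" using a by (simp add: \<psi>_def)
    then show ?thesis using char_\<psi> a(1) nonprincipalI by blast
  qed
  define P where "P S n = (\<Sum>d=1..n. \<psi> S d * mangoldt d / real d)" for S n
  have "\<exists>B. \<forall>n. \<bar>P S n\<bar> \<le> B" if "S \<in> Pow I - {{}}" for S
    using nonprincipal_real_character.mertens_bounded[OF nonprincipal[of S]] that
    unfolding P_def by (metis Diff_iff Pow_iff singletonI)
  then obtain B where B: "\<bar>P S n\<bar> \<le> B S" if "S \<in> Pow I - {{}}" for S n by metis
  define C where "C = (\<Sum>p\<in>prime_factors m. ln (real p)) + 1 + (\<Sum>S\<in>Pow I - {{}}. B S)"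
  \<comment> \<open>In the expansion over subsets, the empty subset contributes at least ln n minus
    a constant, and all others stay bounded by Mertens' estimate.\<close>
  have F_lower: "ln (real n) - C \<le> (\<Sum>d=1..n. F d * mangoldt d / real d)" for n
  proof -
    have "(\<Sum>d=1..n. F d * mangoldt d / real d) = (\<Sum>S\<in>Pow I. (\<Prod>i\<in>S. \<epsilon> i) * P S n)"
      unfolding F_eq P_def sum_distrib_right sum_distrib_left sum_divide_distrib
      by (subst sum.swap) (simp add: mult_ac)
    also have "\<dots> = P {} n + (\<Sum>S\<in>Pow I - {{}}. (\<Prod>i\<in>S. \<epsilon> i) * P S n)"
      using \<open>finite I\<close> by (subst sum.remove[of _ "{}"]) auto
    finally have eq: "(\<Sum>d=1..n. F d * mangoldt d / real d)
        = P {} n + (\<Sum>S\<in>Pow I - {{}}. (\<Prod>i\<in>S. \<epsilon> i) * P S n)" .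
    have "\<bar>\<Sum>S\<in>Pow I - {{}}. (\<Prod>i\<in>S. \<epsilon> i) * P S n\<bar> \<le> (\<Sum>S\<in>Pow I - {{}}. B S)"
    proof (intro order_trans[OF sum_abs] sum_mono)
      fix S assume S: "S \<in> Pow I - {{}}"
      have "\<bar>\<Prod>i\<in>S. \<epsilon> i\<bar> = (\<Prod>i\<in>S. 1)"
        unfolding abs_prod using S sign by (intro prod.cong refl) force
      then show "\<bar>(\<Prod>i\<in>S. \<epsilon> i) * P S n\<bar> \<le> B S" using B[OF S, of n] by (simp add: abs_mult)
    qed
    moreover have "ln (real n) - 1 - (\<Sum>p\<in>prime_factors m. ln (real p)) \<le> P {} n"
    proof -
      have "(\<Sum>d=1..n. mangoldt d / real d)
          = P {} n + (\<Sum>d | d \<in> {1..n} \<and> \<not> coprime d m. mangoldt d / real d)"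
      proof -
        have "(\<Sum>d | d \<in> {1..n} \<and> \<not> coprime d m. mangoldt d / real d)
            = (\<Sum>d=1..n. if \<not> coprime d m then mangoldt d / real d else 0)"
          by (rule sum.inter_filter) simp
        then show ?thesis
          unfolding P_def \<psi>_def by (auto simp flip: sum.distrib intro!: sum.cong)
      qed
      then show ?thesis
        using sum_mangoldt_div_ge[of n] sum_mangoldt_not_coprime_le[OF \<open>m > 0\<close>, of n] by linarith
    qed
    ultimately show ?thesis unfolding eq C_def by linarith
  qed
  obtain n where "C < ln (real n)"
  proof -
    obtain n where "exp (C + 1) < real n" using reals_Archimedean2 by blast
    moreover from this have "0 < real n" using exp_gt_zero less_trans by blast
    ultimately have "ln (exp (C + 1)) < ln (real n)"
      by (subst ln_less_cancel_iff) auto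
    then show ?thesis using that[of n] by simp
  qed
  then have "(\<Sum>d=1..n. F d * mangoldt d / real d) \<noteq> 0" using F_lower[of n] by linarith
  then obtain d where d: "F d * mangoldt d / real d \<noteq> 0"
    by (rule sum.not_neutral_contains_not_neutral)
  then have "primepow d" by (auto simp: mangoldt_def split: if_splits)
  then obtain p k where p: "prime p" "k > 0" "d = p ^ k" unfolding primepow_def by blast
  have "F d \<noteq> 0" using d by auto
  then have cop: "coprime d m" and "(\<Prod>i\<in>I. \<epsilon> i * \<chi> i d + 1) \<noteq> 0"
    by (auto simp: F_def split: if_splits)
  then have "\<epsilon> i * \<chi> i d + 1 \<noteq> 0" if "i \<in> I" for i
    using that \<open>finite I\<close> by auto
  then have chi_d: "\<chi> i p ^ k = \<epsilon> i" if "i \<in> I" for i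
    using that sign[OF that] range[OF that cop] p(3) real_character.char_power[OF char[OF that]]
    by force
  have cop_p: "coprime p m" using cop p by simp
  have "odd k"
  proof
    assume "even k"
    then have "0 \<le> \<chi> i0 p ^ k" by (rule zero_le_even_power)
    then show False using chi_d[OF negative(1)] negative(2) by simp
  qed
  show ?thesis
  proof (rule that[OF p(1)])
    show "\<not> p dvd m" using cop_p p(1) by (metis coprime_absorb_left not_prime_unit)
    fix i assume i: "i \<in> I"
    have "\<chi> i p ^ k = \<chi> i p" using range[OF i cop_p] \<open>odd k\<close> by auto
    then show "\<chi> i p = \<epsilon> i" using chi_d[OF i] by simp
  qed
qed

subsection \<open>Quadratic characters\<close>

lemma real_character_dvd_modulus:
  assumes "real_character \<chi> q" "q dvd m" "m > 0"
  shows "real_character \<chi> m"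
proof -
  interpret real_character \<chi> q by fact
  have shift: "\<chi> (a + q * k) = \<chi> a" for a k
  proof (induction k)
    case (Suc k)
    then show ?case using char_periodic[of "a + q * k"] by (simp add: ac_simps)
  qed simp
  show ?thesis
    using assms(2,3) by unfold_locales
      (use char_mult char_range char_1 in \<open>auto simp: shift elim!: dvdE\<close>)
qed

lemma Legendre_cong: "[a = b] (mod p) \<Longrightarrow> Legendre a p = Legendre b p"
  by (simp add: Legendre_def QuadRes_def cong_def)

lemma Legendre_range: "Legendre a p \<in> {-1, 0, 1}"
  by (simp add: Legendre_def)

lemma Legendre_eq_0_iff: "Legendre a p = 0 \<longleftrightarrow> p dvd a"
  by (simp add: Legendre_def cong_0_iff)

text \<open>Elements of {-1, 0, 1} differ by at most 2, less than p, so congruence forces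
  equality.\<close>

lemma Legendre_unique:
  assumes "2 < p" "[Legendre a p = x] (mod p)" "x \<in> {-1, 0, 1}"
  shows "Legendre a p = x"
proof -
  have "p dvd Legendre a p - x" using assms(2) by (simp add: cong_iff_dvd_diff)
  moreover have "\<bar>Legendre a p - x\<bar> < p" using Legendre_range[of a p] assms(1,3) by auto
  ultimately show ?thesis using zdvd_imp_le[of p "\<bar>Legendre a p - x\<bar>"] by fastforce
qed

lemma Legendre_mult:
  assumes "prime p" "2 < p"
  shows "Legendre (a * b) (int p) = Legendre a (int p) * Legendre b (int p)"
proof (rule Legendre_unique)
  have "[Legendre (a * b) (int p) = (a * b) ^ ((p - 1) div 2)] (mod int p)"
    by (rule euler_criterion[OF assms])
  also have "(a * b) ^ ((p - 1) div 2) = a ^ ((p - 1) div 2) * b ^ ((p - 1) div 2)"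
    by (rule power_mult_distrib)
  also have "[\<dots> = Legendre a (int p) * Legendre b (int p)] (mod int p)"
    by (intro cong_mult cong_sym[OF euler_criterion[OF assms]])
  finally show "[Legendre (a * b) (int p) = Legendre a (int p) * Legendre b (int p)] (mod int p)" .
qed (use assms Legendre_range[of a "int p"] Legendre_range[of b "int p"] in auto)

lemma Legendre_1: "2 < p \<Longrightarrow> Legendre 1 p = 1"
  unfolding Legendre_def QuadRes_def
  by (auto simp: cong_0_iff zdvd_not_zless intro!: exI[of _ 1])

lemma real_character_Legendre:
  assumes "prime p" "2 < p"
  shows "real_character (\<lambda>n. real_of_int (Legendre (int n) (int p))) p"
proof
  fix a b :: nat
  show "real_of_int (Legendre (int (a * b)) (int p))
      = real_of_int (Legendre (int a) (int p)) * real_of_int (Legendre (int b) (int p))"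
    using Legendre_mult[OF assms] by simp
  show "real_of_int (Legendre (int a) (int p)) \<in> {-1, 0, 1}"
    using Legendre_range[of "int a" "int p"] by auto
  show "real_of_int (Legendre (int (a + p)) (int p)) = real_of_int (Legendre (int a) (int p))"
    by (subst Legendre_cong[of "int (a + p)" "int a"]) (auto simp: cong_def)
qed (use assms Legendre_1[of "int p"] in auto)

text \<open>Squaring identifies 1 and p - 1; as a non-injective map of the finite set of nonzero
  residues to itself, it misses some residue.\<close>

lemma quadratic_nonresidue_exists:
  assumes "prime p" "2 < p"
  obtains a :: nat where "Legendre (int a) (int p) = -1"
proof -
  define f where "f y = y\<^sup>2 mod p" for y :: nat
  have maps: "f ` {1..<p} \<subseteq> {1..<p}"
  proof
    fix x assume "x \<in> f ` {1..<p}"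
    then obtain y where y: "y \<in> {1..<p}" "x = y\<^sup>2 mod p" by (auto simp: f_def)
    then have "\<not> p dvd y" using nat_dvd_not_less by auto
    then have "\<not> p dvd y\<^sup>2" using assms(1) prime_dvd_power by blast
    then show "x \<in> {1..<p}" using y assms by (auto simp: Suc_le_eq dvd_eq_mod_eq_0)
  qed
  have "f 1 = f (p - 1)"
  proof -
    have "[(int p - 1)\<^sup>2 = 1] (mod int p)"
      by (simp add: cong_iff_dvd_diff power2_eq_square algebra_simps)
    then have "[(p - 1)\<^sup>2 = 1] (mod p)"
      using assms by (simp flip: cong_int_iff add: of_nat_diff)
    then show ?thesis by (simp add: f_def cong_def)
  qed
  then have "\<not> inj_on f {1..<p}"
    using assms inj_onD[of f "{1..<p}" 1 "p - 1"] by fastforce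
  then have "f ` {1..<p} \<noteq> {1..<p}" using eq_card_imp_inj_on[of "{1..<p}" f] by auto
  then obtain a where a: "a \<in> {1..<p}" "a \<notin> f ` {1..<p}" using maps by blast
  have "\<not> QuadRes (int p) (int a)"
  proof
    assume "QuadRes (int p) (int a)"
    then obtain y where y: "[y\<^sup>2 = int a] (mod int p)" by (auto simp: QuadRes_def)
    define z where "z = nat (y mod int p)"
    have z: "int z = y mod int p" "z < p" using assms by (auto simp: z_def nat_less_iff)
    have "int (z\<^sup>2 mod p) = int a"
      using y a z by (simp add: zmod_int power_mod cong_def flip: of_nat_power)
        (simp add: power_mod)
    then have "f z = a" unfolding f_def by linarith
    moreover have "z \<noteq> 0" using a \<open>f z = a\<close> by (auto simp: f_def)
    ultimately show False using a z by force
  qed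
  moreover have "\<not> int p dvd int a" using a nat_dvd_not_less by auto
  ultimately show ?thesis using that[of a] by (simp add: Legendre_def cong_0_iff)
qed

section \<open>A prime congruent to 5 modulo 8 with prescribed Legendre symbols\<close>

text \<open>This and the next function are the Kronecker symbols (-4/n) and (8/n). The values 1 and
  -1 together single out n congruent to 5 modulo 8.\<close>

definition character_mod_4 :: "nat \<Rightarrow> real" where
  "character_mod_4 n = (if even n then 0 else if n mod 4 = 1 then 1 else -1)"

definition character_mod_8 :: "nat \<Rightarrow> real" where
  "character_mod_8 n = (if even n then 0 else if n mod 8 \<in> {1, 7} then 1 else -1)"

lemma real_character_mod_4: "real_character character_mod_4 8"
proof
  fix a b :: nat
  have odd_cases: "n mod 4 = 1 \<or> n mod 4 = 3" if "odd n" for n :: nat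
    using that by presburger
  have "(a * b) mod 4 = (a mod 4) * (b mod 4) mod 4" by (simp add: mod_mult_eq)
  then show "character_mod_4 (a * b) = character_mod_4 a * character_mod_4 b"
  proof (cases "even a \<or> even b")
    case False
    then have "odd a" "odd b" by auto
    from odd_cases[OF this(1)] odd_cases[OF this(2)] this \<open>(a * b) mod 4 = _\<close> show ?thesis
      by (elim disjE) (simp_all add: character_mod_4_def)
  qed (auto simp: character_mod_4_def)
  have "(a + 8) mod 4 = a mod 4" by presburger
  then show "character_mod_4 (a + 8) = character_mod_4 a" by (simp add: character_mod_4_def)
qed (auto simp: character_mod_4_def)

lemma real_character_mod_8: "real_character character_mod_8 8"
proof
  fix a b :: nat
  have odd_cases: "n mod 8 = 1 \<or> n mod 8 = 3 \<or> n mod 8 = 5 \<or> n mod 8 = 7" if "odd n" for n :: nat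
    using that by presburger
  have "(a * b) mod 8 = (a mod 8) * (b mod 8) mod 8" by (simp add: mod_mult_eq)
  then show "character_mod_8 (a * b) = character_mod_8 a * character_mod_8 b"
  proof (cases "even a \<or> even b")
    case False
    then have "odd a" "odd b" by auto
    from odd_cases[OF this(1)] odd_cases[OF this(2)] this \<open>(a * b) mod 8 = _\<close> show ?thesis
      by (elim disjE) (simp_all add: character_mod_8_def)
  qed (auto simp: character_mod_8_def)
  show "character_mod_8 (a + 8) = character_mod_8 a" by (simp add: character_mod_8_def)
qed (auto simp: character_mod_8_def)

theorem prime_5_mod_8_with_Legendre_symbols:
  fixes \<epsilon> :: "nat \<Rightarrow> int"
  assumes "finite Q" and Q: "\<And>q. q \<in> Q \<Longrightarrow> prime q \<and> 2 < q"
    and sign: "\<And>q. q \<in> Q \<Longrightarrow> \<epsilon> q \<in> {-1, 1}"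
  obtains p where "prime p" "p mod 8 = 5" "p \<notin> Q" "\<And>q. q \<in> Q \<Longrightarrow> Legendre (int p) (int q) = \<epsilon> q"
proof -
  \<comment> \<open>The composite indices 4 and 8 stand for the two characters modulo 8 and cannot
    clash with primes in \<open>Q\<close>. The value -1 at index 8 supplies the required negative
    sign.\<close>
  define \<chi> where "\<chi> i = (if i = 4 then character_mod_4 else if i = 8 then character_mod_8
    else (\<lambda>n. real_of_int (Legendre (int n) (int i))))" for i :: nat
  define \<delta> :: "nat \<Rightarrow> real" where "\<delta> i = (if i = 4 then 1 else if i = 8 then -1 else of_int (\<epsilon> i))" for i
  define m where "m = 8 * \<Prod>Q"
  have not_prime: "\<not> prime (4::nat)" "\<not> prime (8::nat)"
    using prime_product[of 2 2] prime_product[of 2 4] by auto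
  have not_Q: "4 \<notin> Q" "8 \<notin> Q" using Q not_prime by blast+
  have \<chi>_Q: "\<chi> q = (\<lambda>n. real_of_int (Legendre (int n) (int q)))" if "q \<in> Q" for q
    using that not_Q by (auto simp: \<chi>_def)
  have \<chi>_48: "\<chi> 4 = character_mod_4" "\<chi> 8 = character_mod_8" by (simp_all add: \<chi>_def)
  have "\<Prod>Q > 0" using Q by (intro prod_pos) (auto simp: prime_gt_0_nat)
  then have "m > 0" by (simp add: m_def)
  have dvd: "8 dvd m" "q dvd m" if "q \<in> Q" for q
    using dvd_prodI[OF \<open>finite Q\<close> that, of "\<lambda>x. x"] by (simp_all add: m_def)
  have \<chi>_1: "\<chi> 4 a = 1" "\<chi> 8 a = 1" if "[a = 1] (mod 8)" for a
  proof -
    have "a mod 8 = 1" using that by (simp add: cong_def)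
    moreover from this have "odd a" "a mod 4 = 1" by presburger+
    ultimately show "\<chi> 4 a = 1" "\<chi> 8 a = 1" by (simp_all add: \<chi>_48 character_mod_4_def character_mod_8_def)
  qed
  have \<chi>_Q_1: "\<chi> q a = 1" if "q \<in> Q" "[a = 1] (mod q)" for q a
    using Legendre_cong[of "int a" 1 "int q"] Legendre_1[of "int q"] that Q[OF that(1)]
    by (simp add: \<chi>_Q cong_int_iff[of a 1, simplified])
  have coprime_8: "coprime 8 r \<longleftrightarrow> odd r" for r :: nat
    using coprime_power_left_iff[of 2 3 r] by simp
  obtain p where p: "prime p" "\<not> p dvd m" "\<And>i. i \<in> {4, 8} \<union> Q \<Longrightarrow> \<chi> i p = \<delta> i"
  proof (rule prime_with_prescribed_character_values[of "{4, 8} \<union> Q" m \<chi> \<delta> 8])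
    show "finite ({4, 8} \<union> Q)" using \<open>finite Q\<close> by simp
    show "m > 0" by fact
    show "real_character (\<chi> i) m" if "i \<in> {4, 8} \<union> Q" for i
    proof (cases "i \<in> Q")
      case True
      then show ?thesis
        using real_character_dvd_modulus[OF real_character_Legendre] Q dvd \<open>m > 0\<close> by (simp add: \<chi>_Q)
    next
      case False
      then show ?thesis
        using that real_character_dvd_modulus[OF real_character_mod_4] \<open>m > 0\<close>
          real_character_dvd_modulus[OF real_character_mod_8] by (auto simp: \<chi>_48 m_def)
    qed
    show "\<chi> i n \<noteq> 0" if "i \<in> {4, 8} \<union> Q" "coprime n m" for i n
    proof (cases "i \<in> Q")
      case True
      then have "coprime n i" using coprime_divisors[OF dvd_refl dvd(2) that(2)] by blast
      then have "\<not> i dvd n" using Q[OF True] by (metis coprime_absorb_right not_prime_unit)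
      then show ?thesis using True by (simp add: \<chi>_Q Legendre_eq_0_iff)
    next
      case False
      have "odd n" using that(2) coprime_8[of n] by (simp add: m_def coprime_commute)
      then show ?thesis using False that(1)
        by (auto simp: \<chi>_48 character_mod_4_def character_mod_8_def split: if_splits)
    qed
    show "\<delta> i \<in> {-1, 1}" if "i \<in> {4, 8} \<union> Q" for i
      using sign[of i] that by (auto simp: \<delta>_def)
    show "8 \<in> {4, 8} \<union> Q" "\<delta> 8 = -1" by (simp_all add: \<delta>_def)
    fix i assume i: "i \<in> {4, 8} \<union> Q"
    show "\<exists>a. coprime a m \<and> \<chi> i a = -1 \<and> (\<forall>j\<in>{4, 8} \<union> Q - {i}. \<chi> j a = 1)"
    proof (cases "i \<in> Q")
      case True
      obtain b where b: "Legendre (int b) (int i) = -1"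
        using quadratic_nonresidue_exists Q[OF True] by blast
      \<comment> \<open>A nonresidue modulo i that is 1 modulo all the remaining factors changes the
        sign of the character at i only.\<close>
      define m' where "m' = 8 * \<Prod>(Q - {i})"
      have m: "m = i * m'" using True \<open>finite Q\<close> by (simp add: m_def m'_def prod.remove)
      have "coprime i q" if "q \<in> Q - {i}" for q
        using that Q True primes_coprime by blast
      then have "coprime i (\<Prod>(Q - {i}))" by (intro prod_coprime_right) auto
      moreover have "coprime 8 i"
        using Q[OF True] prime_odd_nat by (simp add: coprime_8)
      ultimately have "coprime i m'" by (simp add: m'_def coprime_commute)
      then obtain a where a: "[a = b] (mod i)" "[a = 1] (mod m')"
        using binary_chinese_remainder_nat by blast
      have "Legendre (int a) (int i) = -1"
        using b a(1) Legendre_cong[of "int a" "int b" "int i"] by (simp add: cong_int_iff)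
      moreover from this have "\<not> i dvd a" using Legendre_eq_0_iff[of "int a" "int i"] by auto
      then have "coprime a i" using Q[OF True] prime_imp_coprime coprime_commute by blast
      moreover have "coprime a m'" using a(2) cong_imp_coprime cong_sym coprime_1_left by blast
      moreover have "\<chi> j a = 1" if j: "j \<in> {4, 8} \<union> Q - {i}" for j
      proof (cases "j \<in> Q")
        case True
        then have "j dvd m'"
          using j dvd_prodI[of "Q - {i}" j "\<lambda>x. x"] \<open>finite Q\<close> by (simp add: m'_def)
        from \<chi>_Q_1[OF True cong_dvd_modulus_nat[OF a(2) this]] show ?thesis .
      next
        case False
        have "[a = 1] (mod 8)" using a(2) cong_dvd_modulus_nat[of a 1 m' 8] by (simp add: m'_def)
        then show ?thesis using False j \<chi>_1 by auto
      qed
      ultimately show ?thesis using True by (intro exI[of _ a]) (auto simp: m \<chi>_Q)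
    next
      case False
      \<comment> \<open>The residue 7 modulo 8 negates only \<open>character_mod_4\<close>, and 5
        negates only \<open>character_mod_8\<close>.\<close>
      define r :: nat where "r = (if i = 4 then 7 else 5)"
      have "coprime 8 q" if "q \<in> Q" for q using Q[OF that] prime_odd_nat by (simp add: coprime_8)
      then have "coprime 8 (\<Prod>Q)" by (intro prod_coprime_right) auto
      then obtain a where a: "[a = r] (mod 8)" "[a = 1] (mod \<Prod>Q)"
        using binary_chinese_remainder_nat by blast
      have amod: "a mod 8 = r" using a(1) by (simp add: cong_def r_def)
      then have "odd a" "a mod 4 = r mod 4" by (auto simp: r_def) presburger+
      have "coprime a (\<Prod>Q)" using a(2) cong_imp_coprime cong_sym coprime_1_left by blast
      then have "coprime a m" using \<open>odd a\<close> coprime_8[of a] by (simp add: m_def coprime_commute)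
      moreover have "\<chi> j a = 1" if "j \<in> Q" for j
      proof -
        have "j dvd \<Prod>Q" using that dvd_prodI[of Q j "\<lambda>x. x"] \<open>finite Q\<close> by simp
        from \<chi>_Q_1[OF that cong_dvd_modulus_nat[OF a(2) this]] show ?thesis .
      qed
      moreover have "\<chi> i a = -1" "\<forall>j\<in>{4, 8} - {i}. \<chi> j a = 1"
        using i False \<open>odd a\<close> \<open>a mod 4 = r mod 4\<close> amod
        by (auto simp: \<chi>_48 character_mod_4_def character_mod_8_def r_def)
      ultimately show ?thesis by (intro exI[of _ a]) auto
    qed
  qed blast
  show ?thesis
  proof (rule that[OF p(1)])
    have "character_mod_4 p = 1" "character_mod_8 p = -1"
      using p(3)[of 4] p(3)[of 8] by (simp_all add: \<chi>_48 \<delta>_def)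
    then have "odd p" "p mod 4 = 1" "p mod 8 \<noteq> 1"
      by (auto simp: character_mod_4_def character_mod_8_def split: if_splits)
    then show "p mod 8 = 5" by presburger
    show "p \<notin> Q" using p(2) dvd by blast
    fix q assume q: "q \<in> Q"
    then have "\<delta> q = of_int (\<epsilon> q)" using not_Q by (auto simp: \<delta>_def)
    then show "Legendre (int p) (int q) = \<epsilon> q" using p(3)[of q] q by (simp add: \<chi>_Q)
  qed
qed

subsection \<open>Solvability modulo squarefree numbers\<close>

lemma prime_3_nat: "prime (3::nat)"
  by simp

lemma squarefree_imp_prod_prime_factors_eq:
  fixes n :: nat
  assumes "squarefree n"
  shows "\<Prod>(prime_factors n) = n"
proof -
  have "n \<noteq> 0" using assms not_squarefree_0 by metis
  then have "n = (\<Prod>p\<in>prime_factors n. p ^ multiplicity p n)"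
    by (simp add: prod_prime_factors)
  also have "\<dots> = \<Prod>(prime_factors n)"
    using assms \<open>n \<noteq> 0\<close> by (intro prod.cong) (auto simp: squarefree_factorial_semiring')
  finally show ?thesis by simp
qed

lemma Legendre_neq_0: "\<not> p dvd a \<Longrightarrow> Legendre a p \<in> {-1, 1}"
  using Legendre_range[of a p] Legendre_eq_0_iff[of a p] by auto

lemma Legendre_power2_eq_1: "\<not> p dvd a \<Longrightarrow> Legendre a p * Legendre a p = 1"
  using Legendre_neq_0[of p a] by auto

lemma QuadRes_if_Legendre_eq_1: "Legendre a p = 1 \<Longrightarrow> QuadRes p a"
  by (auto simp: Legendre_def split: if_splits)

lemma Legendre_minus_1:
  assumes "prime p" "2 < p"
  shows "Legendre (-1) (int p) = (-1) ^ ((p - 1) div 2)"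
proof (rule Legendre_unique)
  show "(-1) ^ ((p - 1) div 2) \<in> {-1, 0, 1 :: int}"
    by (cases "even ((p - 1) div 2)") auto
qed (use assms euler_criterion[OF assms, of "-1"] in auto)

text \<open>With i^2 = -1 modulo p, raising (1 + i)^2 = 2 i to the power (p - 1) / 2 gives 1 = (2/p)
  (-1)^((p - 1) / 4), and (p - 1) / 4 is odd.\<close>

lemma Legendre_2_5_mod_8:
  assumes "prime p" "p mod 8 = 5"
  shows "Legendre 2 (int p) = -1"
proof -
  have "2 < p" using assms(2) by (cases "p \<le> 2") (auto simp: le_Suc_eq numeral_2_eq_2)
  define k where "k = (p - 1) div 2"
  have "even k" "odd (k div 2)" using assms(2) unfolding k_def by presburger+
  have "Legendre (-1) (int p) = 1"
    using Legendre_minus_1[OF assms(1) \<open>2 < p\<close>] \<open>even k\<close> by (simp add: k_def)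
  then obtain i where i: "[i\<^sup>2 = -1] (mod int p)"
    using QuadRes_if_Legendre_eq_1 unfolding QuadRes_def by blast
  have i_eq: "[(1 + i)\<^sup>2 = 2 * i] (mod int p)"
  proof -
    have "(1 + i)\<^sup>2 - 2 * i = i\<^sup>2 - (-1)" by (simp add: power2_sum)
    then show ?thesis using i by (simp add: cong_iff_dvd_diff)
  qed
  \<comment> \<open>Otherwise p would divide i^2 - 1, which is -2 modulo p.\<close>
  have "\<not> int p dvd 1 + i"
  proof
    assume "int p dvd 1 + i"
    then have "int p dvd (i - 1) * (1 + i)" by simp
    moreover have "(i - 1) * (1 + i) = i\<^sup>2 - (-1) - 2" by (simp add: power2_eq_square algebra_simps)
    moreover have "int p dvd i\<^sup>2 - (-1)" using i by (simp add: cong_iff_dvd_diff)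
    ultimately have "int p dvd 2" by (metis dvd_diff_right_iff)
    then show False using \<open>2 < p\<close> zdvd_imp_le[of "int p" 2] by auto
  qed
  have "[1 = (1 + i) ^ (2 * k)] (mod int p)"
  proof -
    have "[Legendre (1 + i) (int p) * Legendre (1 + i) (int p) = (1 + i) ^ k * (1 + i) ^ k] (mod int p)"
      unfolding k_def by (intro cong_mult euler_criterion assms \<open>2 < p\<close>)
    then show ?thesis
      using Legendre_power2_eq_1[OF \<open>\<not> int p dvd 1 + i\<close>] by (simp add: mult_2 power_add)
  qed
  also have "(1 + i) ^ (2 * k) = ((1 + i)\<^sup>2) ^ k" by (rule power_mult)
  also have "[\<dots> = (2 * i) ^ k] (mod int p)" by (intro cong_pow i_eq)
  also have "(2 * i) ^ k = 2 ^ k * (i\<^sup>2) ^ (k div 2)"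
    using \<open>even k\<close> by (simp add: power_mult_distrib flip: power_mult)
  also have "[\<dots> = Legendre 2 (int p) * (-1) ^ (k div 2)] (mod int p)"
    using cong_sym[OF euler_criterion[OF assms(1) \<open>2 < p\<close>, of 2]]
    unfolding k_def[symmetric] by (intro cong_mult cong_pow i)
  finally have "[1 = - Legendre 2 (int p)] (mod int p)" using \<open>odd (k div 2)\<close> by simp
  then have "[Legendre 2 (int p) = -1] (mod int p)"
    by (metis cong_minus_minus_iff cong_sym minus_minus)
  then show ?thesis using \<open>2 < p\<close> by (intro Legendre_unique) auto
qed

text \<open>The sign in quadratic reciprocity is 1 since (p - 1) / 2 is even.\<close>

lemma Legendre_swap_5_mod_8:
  assumes "prime p" "p mod 8 = 5" "prime q" "2 < q" "p \<noteq> q"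
  shows "Legendre (int q) (int p) = Legendre (int p) (int q)"
proof -
  have "2 < p" using assms(2) by (cases "p \<le> 2") (auto simp: le_Suc_eq numeral_2_eq_2)
  have "even ((p - 1) div 2)" using assms(2) by presburger
  then have "Legendre (int p) (int q) * Legendre (int q) (int p) = 1"
    using Quadratic_Reciprocity[OF assms(1) \<open>2 < p\<close> assms(3-5)] by simp
  then show ?thesis by (metis zmult_eq_1_iff)
qed

text \<open>Reciprocity between 3 and q has the sign (-1)^((q - 1) / 2) = (-1/q), which is absorbed
  by passing from 3 to -3.\<close>

lemma Legendre_minus_3:
  assumes "prime q" "2 < q" "q \<noteq> 3"
  shows "Legendre (-3) (int q) = Legendre (int q) 3"
proof -
  have "\<not> q dvd 3" using assms by (metis prime_nat_iff primes_dvd_imp_eq prime_3_nat)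
  then have "\<not> int q dvd 3" by (metis int_dvd_int_iff of_nat_numeral)
  have "Legendre 3 (int q) * Legendre (int q) 3 = Legendre (-1) (int q)"
    using Quadratic_Reciprocity[of 3 q] assms Legendre_minus_1[OF assms(1,2)] by simp
  then have "Legendre 3 (int q) * Legendre (-1) (int q) = Legendre (int q) 3"
    using Legendre_power2_eq_1[OF \<open>\<not> int q dvd 3\<close>] by (metis mult.assoc mult_1)
  then show ?thesis using Legendre_mult[OF assms(1,2), of 3 "-1"] by simp
qed

text \<open>By multiplicativity it is enough to compare prime factors q of n. For odd q, (q/p) =
  (p/q) = (-3/q) = (q/3); for q = 2 both symbols are -1, as p is 5 modulo 8.\<close>

lemma Legendre_eq_mod_3:
  assumes p: "prime p" "p mod 8 = 5" "p \<noteq> 3"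
    and n: "squarefree n" "\<not> 3 dvd n"
    and symbols: "\<And>q. q \<in> prime_factors n - {2} \<Longrightarrow> p \<noteq> q \<and> Legendre (int p) (int q) = Legendre (-3) (int q)"
  shows "Legendre (int n) (int p) = Legendre (int n) 3"
proof -
  have "2 < p" using p(2) by (cases "p \<le> 2") (auto simp: le_Suc_eq numeral_2_eq_2)
  have "n = \<Prod>(prime_factors n)"
    using squarefree_imp_prod_prime_factors_eq[OF n(1)] by simp
  moreover have "Legendre (int (\<Prod>Q)) (int p) = Legendre (int (\<Prod>Q)) 3"
    if "finite Q" "Q \<subseteq> prime_factors n" for Q
    using that
  proof (induction Q rule: finite_induct)
    case empty
    then show ?case using Legendre_1 \<open>2 < p\<close> by simp
  next
    case (insert q Q)
    have q: "prime q" "q dvd n" using insert.prems by auto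
    then have "q \<noteq> 3" using n(2) by blast
    have "Legendre (int q) (int p) = Legendre (int q) 3"
    proof (cases "q = 2")
      case True
      have "Legendre 2 3 = -1"
      proof -
        have "[2 = -1] (mod (3::int))" by (simp add: cong_def)
        from Legendre_cong[OF this] show ?thesis using Legendre_minus_1[of 3] by simp
      qed
      then show ?thesis using True Legendre_2_5_mod_8[OF p(1,2)] by simp
    next
      case False
      then have "2 < q" using q(1) by (simp add: prime_ge_2_nat order.not_eq_order_implies_strict)
      then show ?thesis
        using symbols[of q] insert.prems False Legendre_swap_5_mod_8[OF p(1,2) q(1)]
          Legendre_minus_3[OF q(1) _ \<open>q \<noteq> 3\<close>] by auto
    qed
    then show ?case
      using insert Legendre_mult[OF p(1) \<open>2 < p\<close>] Legendre_mult[of 3] by simp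
  qed
  from this[OF _ order_refl] have "Legendre (int (\<Prod>(prime_factors n))) (int p) = Legendre (int (\<Prod>(prime_factors n))) 3"
    by simp
  ultimately show ?thesis by simp
qed

lemma QuadRes_coprime_mult:
  assumes "QuadRes m a" "QuadRes n a" "coprime m n"
  shows "QuadRes (m * n) a"
proof -
  obtain x y where "[x\<^sup>2 = a] (mod m)" "[y\<^sup>2 = a] (mod n)" using assms by (auto simp: QuadRes_def)
  moreover obtain z where "[z = x] (mod m)" "[z = y] (mod n)"
    using binary_chinese_remainder_int[OF assms(3)] by blast
  ultimately have "[z\<^sup>2 = a] (mod m)" "[z\<^sup>2 = a] (mod n)"
    by (meson cong_pow cong_trans)+
  then show ?thesis using assms(3) unfolding QuadRes_def by (blast intro: coprime_cong_mult)
qed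

lemma QuadRes_squarefree:
  fixes n :: nat
  assumes "squarefree n" "\<And>q. q \<in> prime_factors n \<Longrightarrow> QuadRes (int q) a"
  shows "QuadRes (int n) a"
proof -
  have "QuadRes (int (\<Prod>Q)) a" if "finite Q" "Q \<subseteq> prime_factors n" for Q
    using that
  proof (induction Q rule: finite_induct)
    case empty
    then show ?case by (simp add: QuadRes_def)
  next
    case (insert q Q)
    have "coprime q (\<Prod>Q)"
      using insert by (intro prod_coprime_right primes_coprime) auto
    then have "coprime (int q) (int (\<Prod>Q))" by (simp only: coprime_int_iff)
    then have "QuadRes (int q * int (\<Prod>Q)) a"
      using insert assms(2)[of q] by (intro QuadRes_coprime_mult) auto
    then show ?case using insert by simp
  qed
  from this[OF _ order_refl] show ?thesis
    using squarefree_imp_prod_prime_factors_eq[OF assms(1)] by simp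
qed

text \<open>Prescribing (p/q) = (-3/q) at the odd primes q dividing n makes -3 p a square modulo q;
  modulo 2 every integer is one. Since 3 does not divide n, the symbol (p/3) can be chosen
  freely.\<close>

lemma auxiliary_prime:
  fixes n :: nat
  assumes n: "squarefree n" "\<not> 3 dvd n" and e: "e \<in> {-1, 1}"
  obtains p where "prime p" "p mod 8 = 5" "p \<noteq> 3" "Legendre (int p) 3 = e"
    "Legendre (int n) (int p) = Legendre (int n) 3" "QuadRes (int n) (- 3 * int p)" "coprime p n"
proof -
  define Q where "Q = insert 3 (prime_factors n - {2})"
  have Q: "prime q \<and> 2 < q" if "q \<in> Q" for q
    using that by (auto simp: Q_def prime_ge_2_nat order.not_eq_order_implies_strict
        dest: in_prime_factors_imp_prime)
  have not_3: "\<not> int q dvd -3" if "q \<in> prime_factors n" for q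
  proof
    assume "int q dvd -3"
    then have "q dvd 3" by (metis dvd_minus_iff int_dvd_int_iff of_nat_numeral)
    then have "q = 3" using that by (metis in_prime_factors_imp_prime primes_dvd_imp_eq prime_3_nat)
    then show False using n(2) that by (auto dest: in_prime_factors_imp_dvd)
  qed
  define \<epsilon> where "\<epsilon> q = (if q = 3 then e else Legendre (-3) (int q))" for q :: nat
  have \<epsilon>: "\<epsilon> q \<in> {-1, 1}" if "q \<in> Q" for q
    using that e Legendre_neq_0[OF not_3] by (auto simp: Q_def \<epsilon>_def)
  obtain p where p: "prime p" "p mod 8 = 5" "p \<notin> Q"
      "\<And>q. q \<in> Q \<Longrightarrow> Legendre (int p) (int q) = \<epsilon> q"
    using prime_5_mod_8_with_Legendre_symbols[of Q \<epsilon>] Q \<epsilon> by (auto simp: Q_def)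
  have "p \<noteq> 3" "p \<noteq> 2" using p(2,3) by (auto simp: Q_def)
  have symbols: "p \<noteq> q \<and> Legendre (int p) (int q) = Legendre (-3) (int q)"
    if "q \<in> prime_factors n - {2}" for q
    using p(3) p(4)[of q] that n(2) by (auto simp: Q_def \<epsilon>_def dest: in_prime_factors_imp_dvd)
  show ?thesis
  proof (rule that[OF p(1,2) \<open>p \<noteq> 3\<close>])
    show "Legendre (int p) 3 = e" using p(4)[of 3] by (simp add: Q_def \<epsilon>_def)
    show "Legendre (int n) (int p) = Legendre (int n) 3"
      by (rule Legendre_eq_mod_3[OF p(1,2) \<open>p \<noteq> 3\<close> n symbols])
    show "QuadRes (int n) (- 3 * int p)"
    proof (rule QuadRes_squarefree[OF n(1)])
      fix q assume q: "q \<in> prime_factors n"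
      show "QuadRes (int q) (- 3 * int p)"
      proof (cases "q = 2")
        case True
        have "\<exists>y. [y\<^sup>2 = -3 * int p] (mod 2)"
          by (rule exI[of _ "int p"]) (simp add: cong_iff_dvd_diff)
        then show ?thesis using True by (simp add: QuadRes_def)
      next
        case False
        then have "prime q" "2 < q" using q Q[of q] by (auto simp: Q_def)
        then show ?thesis
          using symbols[of q] q False Legendre_mult[of q "-3" "int p"] Legendre_power2_eq_1[OF not_3[OF q]]
          by (intro QuadRes_if_Legendre_eq_1) simp
      qed
    qed
    have "n \<noteq> 0" using n(2) by (metis dvd_0_right)
    then have "\<not> p dvd n"
      using p(1,3) \<open>p \<noteq> 2\<close> n(1) by (auto simp: Q_def prime_factors_dvd)
    then show "coprime p n" using p(1) prime_imp_coprime by blast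
  qed
qed

subsection \<open>Legendre's theorem on ternary forms\<close>

text \<open>The box has more points than there are residue triples, so two points agree under
  \<open>f\<close>; their difference lies in the lattice cut out by the three congruences.\<close>

lemma small_lattice_point:
  fixes a b c :: int and X Y Z :: nat
  assumes pos: "0 < a" "0 < b" "0 < c" and large: "a * b * c < int ((X + 1) * (Y + 1) * (Z + 1))"
  obtains x y z :: int where "(x, y, z) \<noteq> (0, 0, 0)"
    "\<bar>x\<bar> \<le> int X" "\<bar>y\<bar> \<le> int Y" "\<bar>z\<bar> \<le> int Z"
    "[b * y = r3 * z] (mod a)" "[a * x = r2 * z] (mod b)" "[a * x = r1 * y] (mod c)"
proof -
  define f where "f = (\<lambda>(x, y, z). ((b * y - r3 * z) mod a, (a * x - r2 * z) mod b, (a * x - r1 * y) mod c))"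
  define A where "A = {0..int X} \<times> {0..int Y} \<times> {0..int Z}"
  have "card (f ` A) \<le> card ({0..<a} \<times> {0..<b} \<times> {0..<c})"
    by (intro card_mono) (auto simp: f_def pos)
  also have "\<dots> = nat (a * b * c)"
    using pos by (simp add: card_cartesian_product nat_mult_distrib)
  also have "\<dots> < (X + 1) * (Y + 1) * (Z + 1)"
    by (subst nat_less_iff) (use large pos in simp_all)
  also have "\<dots> = card A"
    by (simp add: A_def card_cartesian_product algebra_simps nat_add_distrib)
  finally have "\<not> inj_on f A" by (rule pigeonhole)
  then obtain u v where uv: "u \<in> A" "v \<in> A" "f u = f v" "u \<noteq> v"
    unfolding inj_on_def by blast
  obtain x1 y1 z1 x2 y2 z2 where eq: "u = (x1, y1, z1)" "v = (x2, y2, z2)" by (cases u, cases v) auto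
  show ?thesis
  proof (rule that[of "x1 - x2" "y1 - y2" "z1 - z2"])
    show "(x1 - x2, y1 - y2, z1 - z2) \<noteq> (0, 0, 0)" using uv(4) eq by auto
    show "\<bar>x1 - x2\<bar> \<le> int X" "\<bar>y1 - y2\<bar> \<le> int Y" "\<bar>z1 - z2\<bar> \<le> int Z"
      using uv(1,2) by (auto simp: eq A_def)
    show "[b * (y1 - y2) = r3 * (z1 - z2)] (mod a)" "[a * (x1 - x2) = r2 * (z1 - z2)] (mod b)"
      "[a * (x1 - x2) = r1 * (y1 - y2)] (mod c)"
      using uv(3) unfolding eq f_def
      by (auto simp: cong_iff_dvd_diff mod_eq_dvd_iff algebra_simps)
  qed
qed

text \<open>Each factor exceeds the true square root, and the three roots multiply to a b c;
  comparing squares stays within the integers.\<close>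

lemma floor_sqrt_prod_gt:
  fixes a b c :: nat
  shows "a * b * c < (floor_sqrt (b * c) + 1) * (floor_sqrt (a * c) + 1) * (floor_sqrt (a * b) + 1)"
proof (rule power2_less_imp_less)
  have "(a * b * c)\<^sup>2 = (b * c) * (a * c) * (a * b)" by (simp add: power2_eq_square mult_ac)
  also have "\<dots> < (Suc (floor_sqrt (b * c)))\<^sup>2 * (Suc (floor_sqrt (a * c)))\<^sup>2 * (Suc (floor_sqrt (a * b)))\<^sup>2"
    by (intro mult_strict_mono Suc_floor_sqrt_power2_gt) auto
  finally show "(a * b * c)\<^sup>2 < ((floor_sqrt (b * c) + 1) * (floor_sqrt (a * c) + 1) * (floor_sqrt (a * b) + 1))\<^sup>2"
    by (simp only: power_mult_distrib Suc_eq_plus1)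
qed simp

lemma power2_le_if_abs_le_floor_sqrt:
  assumes "\<bar>x\<bar> \<le> int (floor_sqrt n)"
  shows "x\<^sup>2 \<le> int n"
proof -
  have "x\<^sup>2 \<le> (int (floor_sqrt n))\<^sup>2" using assms by (metis abs_ge_zero power2_abs power_mono)
  also have "\<dots> \<le> int n" by (metis floor_sqrt_power2_le of_nat_le_iff of_nat_power)
  finally show ?thesis .
qed

text \<open>A small lattice point makes V = a x^2 + b y^2 - c z^2 divisible by a b c and strictly
  between -a b c and 2 a b c, so V is 0 or a b c. The \<open>nonsquare\<close> hypotheses make the
  bounds on x and z strict.\<close>

theorem legendre_ternary:
  fixes a b c :: nat
  assumes pos: "0 < a" "0 < b" "0 < c"
    and coprime: "coprime a b" "coprime a c" "coprime b c"
    and residues: "QuadRes (int c) (- int (a * b))" "QuadRes (int b) (int (a * c))" "QuadRes (int a) (int (b * c))"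
    and nonsquare: "\<And>x. x\<^sup>2 \<noteq> int (a * b)" "\<And>x. x\<^sup>2 \<noteq> int (b * c)"
  obtains x y z :: int where "z \<noteq> 0" "int a * x\<^sup>2 + int b * y\<^sup>2 = int c * z\<^sup>2"
proof -
  obtain r1 r2 r3 where r: "[r1\<^sup>2 = - int (a * b)] (mod int c)" "[r2\<^sup>2 = int (a * c)] (mod int b)"
      "[r3\<^sup>2 = int (b * c)] (mod int a)"
    using residues by (auto simp: QuadRes_def)
  obtain x y z where nz: "(x, y, z) \<noteq> (0, 0, 0)"
    and le: "\<bar>x\<bar> \<le> int (floor_sqrt (b * c))" "\<bar>y\<bar> \<le> int (floor_sqrt (a * c))" "\<bar>z\<bar> \<le> int (floor_sqrt (a * b))"
    and cong: "[int b * y = r3 * z] (mod int a)" "[int a * x = r2 * z] (mod int b)" "[int a * x = r1 * y] (mod int c)"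
  proof (rule small_lattice_point[of "int a" "int b" "int c"])
    show "int a * int b * int c < int ((floor_sqrt (b * c) + 1) * (floor_sqrt (a * c) + 1) * (floor_sqrt (a * b) + 1))"
      using floor_sqrt_prod_gt[of a b c] by (metis of_nat_less_iff of_nat_mult)
  qed (use pos in auto)
  define V where "V = int a * x\<^sup>2 + int b * y\<^sup>2 - int c * z\<^sup>2"
  \<comment> \<open>Multiplied by the unit e, V becomes (e u)^2 - t v^2 modulo d, which vanishes
    because e u is s v and s^2 is t.\<close>
  have V_dvd: "int d dvd V"
    if "coprime e d" "[s\<^sup>2 = t] (mod int d)" "[int e * u = s * v] (mod int d)"
      "int e * V = (int e * u)\<^sup>2 - t * v\<^sup>2 + int d * w" for d e s t u v w
  proof -
    have "[(int e * u)\<^sup>2 = t * v\<^sup>2] (mod int d)"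
      using cong_pow[OF that(3), of 2] cong_scalar_right[OF that(2), of "v\<^sup>2"]
      by (metis cong_trans power_mult_distrib)
    then have "int d dvd (int e * u)\<^sup>2 - t * v\<^sup>2" by (simp add: cong_iff_dvd_diff)
    then have "int d dvd int e * V" unfolding that(4) by simp
    then show ?thesis using that(1) by (metis coprime_commute coprime_dvd_mult_right_iff coprime_int_iff)
  qed
  have "int c dvd V"
    by (rule V_dvd[OF coprime(2) r(1) cong(3), of "- int a * z\<^sup>2"])
      (simp add: V_def power2_eq_square algebra_simps)
  moreover have "int b dvd V"
    by (rule V_dvd[OF coprime(1) r(2) cong(2), of "int a * y\<^sup>2"])
      (simp add: V_def power2_eq_square algebra_simps)
  moreover have "int a dvd V"
    by (rule V_dvd[OF _ r(3) cong(1), of "int b * x\<^sup>2"])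
      (use coprime in \<open>simp_all add: V_def power2_eq_square algebra_simps coprime_commute\<close>)
  ultimately have "int (a * b * c) dvd V"
    using coprime by (simp add: divides_mult)
  then obtain k where k: "V = int (a * b * c) * k" by blast
  have x2: "x\<^sup>2 < int (b * c)"
    using power2_le_if_abs_le_floor_sqrt[OF le(1)] nonsquare(2)[of x] by linarith
  have y2: "y\<^sup>2 \<le> int (a * c)" by (rule power2_le_if_abs_le_floor_sqrt[OF le(2)])
  have z2: "z\<^sup>2 < int (a * b)"
    using power2_le_if_abs_le_floor_sqrt[OF le(3)] nonsquare(1)[of z] by linarith
  define N where "N = int (a * b * c)"
  have N: "int a * x\<^sup>2 < N" "int b * y\<^sup>2 \<le> N" "int c * z\<^sup>2 < N"
    using mult_strict_left_mono[OF x2, of "int a"] mult_left_mono[OF y2, of "int b"]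
      mult_strict_left_mono[OF z2, of "int c"] pos by (simp_all add: N_def mult_ac)
  have "0 \<le> int a * x\<^sup>2" "0 \<le> int b * y\<^sup>2" "0 \<le> int c * z\<^sup>2" by simp_all
  with N have "- N < V" "V < 2 * N" unfolding V_def by linarith+
  moreover have "N > 0" using pos by (simp add: N_def)
  ultimately have "k = 0 \<or> k = 1"
    unfolding k N_def[symmetric]
    using mult_less_cancel_left_pos[of N "-1" k] mult_less_cancel_left_pos[of N k 2] by auto
  then show ?thesis
  proof
    assume "k = 0"
    then have V0: "int a * x\<^sup>2 + int b * y\<^sup>2 = int c * z\<^sup>2" using k by (simp add: V_def)
    moreover have "z \<noteq> 0"
    proof
      assume "z = 0"
      then have "int a * x\<^sup>2 + int b * y\<^sup>2 = 0" using V0 by simp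
      then have "int a * x\<^sup>2 = 0" "int b * y\<^sup>2 = 0"
        using \<open>0 \<le> int a * x\<^sup>2\<close> \<open>0 \<le> int b * y\<^sup>2\<close> by linarith+
      then show False using nz \<open>z = 0\<close> pos by simp
    qed
    ultimately show ?thesis using that by blast
  next
    \<comment> \<open>Composing \<open>a x\<^sup>2 + b y\<^sup>2 = c (z\<^sup>2 + a b)\<close> with the norm \<open>z\<^sup>2 + a b \<cdot> 1\<^sup>2\<close> makes the cofactor a square.\<close>
    assume "k = 1"
    then have V1: "int a * x\<^sup>2 + int b * y\<^sup>2 = int c * (z\<^sup>2 + int a * int b)"
      using k by (simp add: V_def algebra_simps)
    have "int a * (x * z - int b * y)\<^sup>2 + int b * (int a * x + y * z)\<^sup>2
        = (int a * x\<^sup>2 + int b * y\<^sup>2) * (z\<^sup>2 + int a * int b)"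
      by (simp add: power2_eq_square algebra_simps)
    also have "\<dots> = int c * (z\<^sup>2 + int a * int b)\<^sup>2" unfolding V1 by (simp add: power2_eq_square)
    finally show ?thesis
    proof (rule that[rotated])
      have "0 < int a * int b" using pos by simp
      then show "z\<^sup>2 + int a * int b \<noteq> 0" using zero_le_power2[of z] by linarith
    qed
  qed
qed

section \<open>Sums of two squares and rational representations by x^2 + y^2 + 3 z^2\<close>

lemma prime_nonsquare:
  assumes "prime (p::nat)" "\<not> p dvd k"
  shows "x\<^sup>2 \<noteq> int (p * k)"
proof
  assume eq: "x\<^sup>2 = int (p * k)"
  then have "int p dvd x\<^sup>2" by simp
  then have "int p dvd x" using assms(1) prime_dvd_power by (metis prime_nat_int_transfer)
  then obtain y where "x = int p * y" by blast
  then have "int p * (int p * y\<^sup>2) = int p * int k" using eq by (simp add: power2_eq_square mult_ac)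
  then have "int p * y\<^sup>2 = int k" using assms(1) prime_gt_0_nat by fastforce
  then have "int p dvd int k" by (metis dvd_triv_left)
  then show False using assms(2) by simp
qed

text \<open>Thue's argument: with i a root of -1 modulo p, a small point with x congruent to i y
  makes x^2 + y^2 a multiple of p strictly between 0 and 2 p. The bound 0 switches off the third
  coordinate of the lattice point.\<close>

lemma prime_5_mod_8_sum_two_squares:
  assumes "prime p" "p mod 8 = 5"
  obtains u v :: int where "int p = u\<^sup>2 + v\<^sup>2"
proof -
  have "2 < p" using assms(2) by (cases "p \<le> 2") (auto simp: le_Suc_eq numeral_2_eq_2)
  have "even ((p - 1) div 2)" using assms(2) by presburger
  then have "Legendre (-1) (int p) = 1" using Legendre_minus_1[OF assms(1) \<open>2 < p\<close>] by simp
  then obtain i where i: "[i\<^sup>2 = -1] (mod int p)"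
    using QuadRes_if_Legendre_eq_1 unfolding QuadRes_def by blast
  obtain x y z where nz: "(x, y, z) \<noteq> (0, 0, 0)"
    and le: "\<bar>x\<bar> \<le> int (floor_sqrt p)" "\<bar>y\<bar> \<le> int (floor_sqrt p)" "\<bar>z\<bar> \<le> int 0"
    and cong: "[1 * x = i * y] (mod int p)"
  proof (rule small_lattice_point[of 1 1 "int p"])
    have "int p < int ((Suc (floor_sqrt p))\<^sup>2)"
      unfolding of_nat_less_iff by (rule Suc_floor_sqrt_power2_gt)
    then show "1 * 1 * int p < int ((floor_sqrt p + 1) * (floor_sqrt p + 1) * (0 + 1))"
      by (simp add: power2_eq_square algebra_simps)
  qed (use \<open>2 < p\<close> in auto)
  have "[x\<^sup>2 = (-1) * y\<^sup>2] (mod int p)"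
    using cong_pow[OF cong, of 2] cong_scalar_right[OF i, of "y\<^sup>2"]
    by (metis cong_trans mult_1 power_mult_distrib)
  then have "int p dvd x\<^sup>2 + y\<^sup>2" by (simp add: cong_iff_dvd_diff)
  then obtain k where k: "x\<^sup>2 + y\<^sup>2 = int p * k" by blast
  have "x\<^sup>2 < int p" "y\<^sup>2 < int p"
    using power2_le_if_abs_le_floor_sqrt[OF le(1)] power2_le_if_abs_le_floor_sqrt[OF le(2)]
      prime_nonsquare[OF assms(1), of 1] \<open>2 < p\<close> by (auto simp: order.strict_iff_order)
  moreover have "0 < x\<^sup>2 + y\<^sup>2" using nz le(3) by (auto simp: sum_power2_gt_zero_iff)
  ultimately have "int p * 0 < int p * k" "int p * k < int p * 2" using k by linarith+
  then have "0 < k" "k < 2" using \<open>2 < p\<close> by (simp_all only: mult_less_cancel_left_pos)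
  then have "k = 1" by simp
  then show ?thesis using that[of x y] k by simp
qed

text \<open>Legendre's theorem is applied to p x^2 + 3 y^2 = n t^2. The symbols modulo 3 and p are
  (p/3)(n/3) and (3/p)(n/p), both equal to (n/3)^2 = 1 by the choice of p. Writing p as a sum of two
  squares splits p x^2.\<close>

lemma rational_representation_coprime_3:
  assumes n: "squarefree n" "\<not> 3 dvd n"
  obtains t x y z :: int where "t \<noteq> 0" "int n * t\<^sup>2 = x\<^sup>2 + y\<^sup>2 + 3 * z\<^sup>2"
proof -
  have "\<not> 3 dvd int n" using n(2) by presburger
  obtain p where p: "prime p" "p mod 8 = 5" "p \<noteq> 3" "Legendre (int p) 3 = Legendre (int n) 3"
      "Legendre (int n) (int p) = Legendre (int n) 3" "QuadRes (int n) (- 3 * int p)" "coprime p n"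
    using auxiliary_prime[OF n, of "Legendre (int n) 3"] Legendre_neq_0[OF \<open>\<not> 3 dvd int n\<close>] by metis
  obtain u v where uv: "int p = u\<^sup>2 + v\<^sup>2" using prime_5_mod_8_sum_two_squares[OF p(1,2)] by blast
  have "2 < p" using p(2) by (cases "p \<le> 2") (auto simp: le_Suc_eq numeral_2_eq_2)
  have not_dvd: "\<not> 3 dvd p" using p(1,3) prime_3_nat primes_dvd_imp_eq by blast
  have "coprime 3 n" using n(2) prime_3_nat prime_imp_coprime by blast
  have eq_1: "Legendre (int n) 3 * Legendre (int n) 3 = 1"
    by (rule Legendre_power2_eq_1) fact
  obtain x y t where "t \<noteq> 0" "int p * x\<^sup>2 + int 3 * y\<^sup>2 = int n * t\<^sup>2"
  proof (rule legendre_ternary[of p 3 n])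
    show "coprime p 3" using not_dvd prime_3_nat prime_imp_coprime coprime_commute by blast
    show "QuadRes (int n) (- int (p * 3))" using p(6) by (simp add: mult.commute)
    show "QuadRes (int 3) (int (p * n))"
      using Legendre_mult[OF prime_3_nat, of "int p" "int n"] p(4) eq_1
      by (intro QuadRes_if_Legendre_eq_1) simp
    show "QuadRes (int p) (int (3 * n))"
      using Legendre_mult[OF p(1) \<open>2 < p\<close>, of 3 "int n"] p(4,5) eq_1
        Legendre_swap_5_mod_8[OF p(1,2) prime_3_nat _ p(3)]
      by (intro QuadRes_if_Legendre_eq_1) simp
    show "x\<^sup>2 \<noteq> int (p * 3)" "x\<^sup>2 \<noteq> int (3 * n)" for x
      using prime_nonsquare[OF prime_3_nat not_dvd] prime_nonsquare[OF prime_3_nat n(2)]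
      by (auto simp: mult.commute)
    show "0 < n" using n by (auto intro: Nat.gr0I)
  qed (use p \<open>coprime 3 n\<close> \<open>2 < p\<close> in auto)
  then show ?thesis
    using that[of t "u * x" "v * x" y] uv by (simp add: power_mult_distrib algebra_simps)
qed

text \<open>Three times a solution of x^2 + 3 p y^2 = n t^2 has the desired shape, p = u^2 + v^2
  turning 9 p y^2 into two squares. As n is 1 modulo 3, it is a square modulo 3 and, by the choice
  of p, modulo p.\<close>

lemma rational_representation_3_times:
  assumes n: "squarefree n" "n mod 3 = 1"
  obtains t x y z :: int where "t \<noteq> 0" "int (3 * n) * t\<^sup>2 = x\<^sup>2 + y\<^sup>2 + 3 * z\<^sup>2"
proof -
  have "\<not> 3 dvd n" using n(2) by presburger
  obtain p where p: "prime p" "p mod 8 = 5" "p \<noteq> 3"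
      "Legendre (int n) (int p) = Legendre (int n) 3" "QuadRes (int n) (- 3 * int p)" "coprime p n"
    using auxiliary_prime[OF n(1) \<open>\<not> 3 dvd n\<close>, of 1] by auto
  obtain u v where uv: "int p = u\<^sup>2 + v\<^sup>2" using prime_5_mod_8_sum_two_squares[OF p(1,2)] by blast
  have "2 < p" using p(2) by (cases "p \<le> 2") (auto simp: le_Suc_eq numeral_2_eq_2)
  have not_dvd: "\<not> 3 dvd p" using p(1,3) prime_3_nat primes_dvd_imp_eq by blast
  have "int n mod 3 = 1" using n(2) by presburger
  then have "[int n = 1] (mod 3)" by (simp add: cong_def)
  then have "Legendre (int n) 3 = 1" using Legendre_cong Legendre_1 by fastforce
  then have QR: "QuadRes 3 (int n)" "QuadRes (int p) (int n)" using p(4) QuadRes_if_Legendre_eq_1 by auto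
  have "coprime 3 n" using \<open>\<not> 3 dvd n\<close> prime_3_nat prime_imp_coprime by blast
  obtain x y t where xyt: "t \<noteq> 0" "int 1 * x\<^sup>2 + int (3 * p) * y\<^sup>2 = int n * t\<^sup>2"
  proof (rule legendre_ternary[of 1 "3 * p" n])
    have "coprime (3 :: int) (int p)"
      using not_dvd prime_3_nat prime_imp_coprime by (metis coprime_int_iff of_nat_numeral)
    then show "QuadRes (int (3 * p)) (int (1 * n))" using QuadRes_coprime_mult[OF QR] by simp
    show "QuadRes (int 1) (int (3 * p * n))" by (simp add: QuadRes_def)
    have "\<not> 3 dvd p * n" using not_dvd \<open>\<not> 3 dvd n\<close> prime_3_nat prime_dvd_mult_iff by blast
    then show "x\<^sup>2 \<noteq> int (1 * (3 * p))" "x\<^sup>2 \<noteq> int (3 * p * n)" for x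
      using prime_nonsquare[OF prime_3_nat not_dvd] prime_nonsquare[OF prime_3_nat, of "p * n"]
      by (auto simp: mult.assoc)
    show "0 < n" using n by (auto intro: Nat.gr0I)
  qed (use p \<open>coprime 3 n\<close> \<open>2 < p\<close> in auto)
  have "int (3 * n) * t\<^sup>2 = 3 * (int n * t\<^sup>2)" by simp
  also have "int n * t\<^sup>2 = x\<^sup>2 + 3 * (u\<^sup>2 + v\<^sup>2) * y\<^sup>2" using xyt(2) uv by simp
  finally show ?thesis
    using that[of t "3 * u * y" "3 * v * y" x] xyt(1) by (simp add: power_mult_distrib algebra_simps)
qed

subsection \<open>From rational to integral representations\<close>

text \<open>Its restriction to even v is x^2 + y^2 + 3 z^2. The descent works on the larger lattice:
  the diagonal form itself is at least 5/4 on the differences between (1/2, 1/2, 1/2) and integer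
  points.\<close>

definition hex_form :: "int \<Rightarrow> int \<Rightarrow> int \<Rightarrow> int" where
  "hex_form x u v = x\<^sup>2 + u\<^sup>2 + u * v + v\<^sup>2"

lemma hex_form_nonneg: "0 \<le> hex_form x u v"
  and hex_form_eq_0: "hex_form x u v = 0 \<Longrightarrow> x = 0 \<and> u = 0 \<and> v = 0"
proof -
  have eq: "4 * hex_form x u v = (2 * x)\<^sup>2 + (2 * u + v)\<^sup>2 + 3 * v\<^sup>2"
    by (simp add: hex_form_def power2_eq_square algebra_simps)
  have "0 \<le> (2 * x)\<^sup>2" "0 \<le> (2 * u + v)\<^sup>2" "0 \<le> 3 * v\<^sup>2" by simp_all
  then show "0 \<le> hex_form x u v" using eq by linarith
  assume "hex_form x u v = 0"
  then have "(2 * x)\<^sup>2 = 0" "(2 * u + v)\<^sup>2 = 0" "3 * v\<^sup>2 = 0"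
    using eq \<open>0 \<le> (2 * x)\<^sup>2\<close> \<open>0 \<le> (2 * u + v)\<^sup>2\<close> \<open>0 \<le> 3 * v\<^sup>2\<close> by linarith+
  then show "x = 0 \<and> u = 0 \<and> v = 0" by simp
qed

lemma nearest_multiple:
  fixes t x :: int
  assumes "0 < t"
  obtains a where "\<bar>2 * (t * a - x)\<bar> \<le> t"
proof -
  define a where "a = (2 * x + t) div (2 * t)"
  have "2 * t * a + (2 * x + t) mod (2 * t) = 2 * x + t" by (simp add: a_def)
  moreover have "0 \<le> (2 * x + t) mod (2 * t)" "(2 * x + t) mod (2 * t) < 2 * t" using assms by simp_all
  ultimately have "\<bar>2 * (t * a - x)\<bar> \<le> t" by (simp add: algebra_simps abs_le_iff)
  then show ?thesis by (rule that)
qed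

text \<open>Rounding leaves errors e, r, s of at most t / 2 in absolute value, so the form is at
  most t^2, and equality can occur only if r = s and 2 |r| = t.\<close>

lemma near_lattice_point:
  fixes t x u v :: int
  assumes "0 < t"
  obtains a b c where "hex_form (t * a - x) (t * b - u) (t * c - v) < t\<^sup>2"
proof -
  obtain a b c where abc: "\<bar>2 * (t * a - x)\<bar> \<le> t" "\<bar>2 * (t * b - u)\<bar> \<le> t" "\<bar>2 * (t * c - v)\<bar> \<le> t"
    using nearest_multiple[OF assms] by metis
  define e r s where "e = t * a - x" and "r = t * b - u" and "s = t * c - v"
  have square_le: "4 * w\<^sup>2 \<le> t\<^sup>2" if "\<bar>2 * w\<bar> \<le> t" for w
    using power_mono[OF that, of 2] by (simp add: power_mult_distrib)
  have sq: "4 * e\<^sup>2 \<le> t\<^sup>2" "4 * r\<^sup>2 \<le> t\<^sup>2" "4 * s\<^sup>2 \<le> t\<^sup>2"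
    using abc square_le by (simp_all add: e_def r_def s_def)
  have t2: "0 < t\<^sup>2" using assms by simp
  show ?thesis
  proof (cases "r = s \<and> 2 * \<bar>r\<bar> = t")
    case True
    \<comment> \<open>rounding to this corner can leave distance exactly 1: move to an adjacent lattice point\<close>
    define d where "d = (if r > 0 then 1 else - 1 :: int)"
    have "t * (b - d) - u = - r"
      using True assms by (auto simp: d_def r_def algebra_simps split: if_splits)
    moreover have "hex_form e (- r) s = e\<^sup>2 + r\<^sup>2"
      using True by (simp add: hex_form_def power2_eq_square)
    moreover have "e\<^sup>2 + r\<^sup>2 < t\<^sup>2" using sq t2 by linarith
    ultimately show ?thesis using that[of a "b - d" c] by (simp add: e_def s_def)
  next
    case False
    have "2 * (r * s) \<le> r\<^sup>2 + s\<^sup>2" using zero_le_power2[of "r - s"] by (simp add: power2_diff)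
    moreover have "4 * r\<^sup>2 < t\<^sup>2 \<or> 2 * (r * s) < r\<^sup>2 + s\<^sup>2"
    proof (rule ccontr)
      assume "\<not> ?thesis"
      then have "t\<^sup>2 \<le> (2 * r)\<^sup>2" "r\<^sup>2 + s\<^sup>2 - 2 * (r * s) \<le> 0" by (auto simp: power_mult_distrib)
      then have "t \<le> \<bar>2 * r\<bar>" "(r - s)\<^sup>2 \<le> 0"
        using assms abs_le_square_iff[of t "2 * r"] by (simp_all add: power2_diff)
      then show False using False abc(2) by (simp add: r_def[symmetric])
    qed
    ultimately have "hex_form e r s < t\<^sup>2"
      unfolding hex_form_def using sq t2 by linarith
    then show ?thesis using that[of a b c] by (simp add: e_def r_def s_def)
  qed
qed

text \<open>The line through the rational point (x, u, v) / t and a near lattice point (a, b, c)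
  meets the quadric of level n in a second rational point. Its denominator t' satisfies t t' =
  \<open>hex_form (t * a - x) (t * b - u) (t * c - v)\<close> < t^2.\<close>

lemma davenport_cassels_step:
  fixes t n x u v :: int
  assumes "1 < t" "n * t\<^sup>2 = hex_form x u v"
  obtains t' x' u' v' where "0 < t'" "t' < t" "n * t'\<^sup>2 = hex_form x' u' v'"
proof -
  obtain a b c where near: "hex_form (t * a - x) (t * b - u) (t * c - v) < t\<^sup>2"
    using near_lattice_point[of t x u v] assms(1) by fastforce
  \<comment> \<open>\<open>P\<close> is the polar form at the two points; \<open>\<alpha>\<close>
    and \<open>\<beta>\<close> are the coefficients with which they combine to the second
    intersection point.\<close>
  define P where "P = 2 * x * a + 2 * u * b + u * c + v * b + 2 * v * c"
  define \<alpha> where "\<alpha> = hex_form a b c - n"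
  define \<beta> where "\<beta> = 2 * n * t - P"
  define t' where "t' = \<alpha> * t + \<beta>"
  have t_t': "t * t' = hex_form (t * a - x) (t * b - u) (t * c - v)"
  proof -
    have "hex_form (t * a - x) (t * b - u) (t * c - v) = t\<^sup>2 * hex_form a b c - t * P + hex_form x u v"
      by (simp add: hex_form_def P_def power2_eq_square algebra_simps)
    then show ?thesis
      unfolding assms(2)[symmetric] t'_def \<alpha>_def \<beta>_def by (simp add: power2_eq_square algebra_simps)
  qed
  have t'_less: "t' < t"
    using near assms(1) mult_less_cancel_left_pos[of t t' t] unfolding t_t'[symmetric] power2_eq_square by simp
  have "n * t'\<^sup>2 = hex_form (\<alpha> * x + \<beta> * a) (\<alpha> * u + \<beta> * b) (\<alpha> * v + \<beta> * c)"
  proof -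
    have "hex_form (\<alpha> * x + \<beta> * a) (\<alpha> * u + \<beta> * b) (\<alpha> * v + \<beta> * c)
        = \<alpha>\<^sup>2 * hex_form x u v + \<alpha> * \<beta> * P + \<beta>\<^sup>2 * hex_form a b c"
      by (simp add: hex_form_def P_def power2_eq_square algebra_simps)
    also have "\<dots> = \<alpha>\<^sup>2 * (n * t\<^sup>2) + \<alpha> * \<beta> * (2 * n * t - \<beta>) + \<beta>\<^sup>2 * (n + \<alpha>)"
      unfolding assms(2) by (simp add: \<alpha>_def \<beta>_def)
    also have "\<dots> = n * t'\<^sup>2"
      by (simp add: t'_def power2_eq_square algebra_simps)
    finally show ?thesis by simp
  qed
  moreover have "0 \<le> t * t'" unfolding t_t' by (rule hex_form_nonneg)
  ultimately show ?thesis
  proof (cases "t' = 0")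
    \<comment> \<open>The rational point then coincides with the lattice point, which represents n
      with denominator 1.\<close>
    case True
    then have "t * a = x" "t * b = u" "t * c = v"
      using t_t' hex_form_eq_0[of "t * a - x" "t * b - u" "t * c - v"] by auto
    then have "n * t\<^sup>2 = t\<^sup>2 * hex_form a b c"
      using assms(2) by (auto simp: hex_form_def power2_eq_square algebra_simps)
    then have "n * 1\<^sup>2 = hex_form a b c" using assms(1) by simp
    then show ?thesis using that[of 1 a b c] assms(1) by simp
  next
    case False
    then have "0 < t'" using \<open>0 \<le> t * t'\<close> assms(1) by (simp add: zero_le_mult_iff)
    then show ?thesis using that t'_less \<open>n * t'\<^sup>2 = _\<close> by blast
  qed
qed

lemma davenport_cassels:
  assumes "t \<noteq> 0" "n * t\<^sup>2 = hex_form x u v"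
  shows "\<exists>x u v. n = hex_form x u v"
  using assms
proof (induction "nat \<bar>t\<bar>" arbitrary: t x u v rule: less_induct)
  case less
  show ?case
  proof (cases "\<bar>t\<bar> = 1")
    case True
    then have "t\<^sup>2 = 1" by (metis one_power2 power2_abs)
    then show ?thesis using less.prems(2) by (metis mult.right_neutral)
  next
    case False
    then have "1 < \<bar>t\<bar>" using less.prems(1) by linarith
    moreover have "n * \<bar>t\<bar>\<^sup>2 = hex_form x u v" using less.prems(2) by simp
    ultimately obtain t' x' u' v' where "0 < t'" "t' < \<bar>t\<bar>" "n * t'\<^sup>2 = hex_form x' u' v'"
      by (rule davenport_cassels_step)
    then show ?thesis using less.hyps[of t' x' u' v'] by simp
  qed
qed

text \<open>One of u, v, u + v is even; symmetries of u^2 + u v + v^2 bring it to the last place,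
  where completing the square gives y^2 + 3 z^2.\<close>

lemma hex_form_to_diagonal:
  obtains y z where "hex_form x u v = x\<^sup>2 + y\<^sup>2 + 3 * z\<^sup>2"
proof -
  have even_case: "\<exists>y z. hex_form x u v = x\<^sup>2 + y\<^sup>2 + 3 * z\<^sup>2" if "even v" for u v
  proof -
    obtain z where "v = 2 * z" using \<open>even v\<close> by blast
    then have "hex_form x u v = x\<^sup>2 + (u + z)\<^sup>2 + 3 * z\<^sup>2"
      by (simp add: hex_form_def power2_eq_square algebra_simps)
    then show ?thesis by blast
  qed
  have "hex_form x u v = hex_form x v u" "hex_form x u v = hex_form x (- v) (u + v)"
    by (simp_all add: hex_form_def power2_eq_square algebra_simps)
  moreover have "even v \<or> even u \<or> even (u + v)" by auto
  ultimately show ?thesis using even_case that by metis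
qed

section \<open>Integers represented by the two diagonal forms\<close>

text \<open>It suffices to represent the squarefree part m. If m = 3 m', then neither m' nor k is
  divisible by 3, so n is 3 m' modulo 9, and excluding the residue 6 leaves m' congruent to 1 modulo
  3.\<close>

theorem represented_by_diag_1_1_3:
  assumes "n > 0" "\<not> 9 dvd n" "n mod 9 \<noteq> (6::nat)"
  obtains x y z :: int where "int n = x\<^sup>2 + y\<^sup>2 + 3 * z\<^sup>2"
proof -
  define m k where "m = squarefree_part n" and "k = square_part n"
  have n: "n = m * k\<^sup>2" unfolding m_def k_def by (rule squarefree_decompose)
  have m: "squarefree m" by (simp add: m_def)
  have "\<exists>t x y z. t \<noteq> 0 \<and> int m * t\<^sup>2 = x\<^sup>2 + y\<^sup>2 + 3 * (z::int)\<^sup>2"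
  proof (cases "3 dvd m")
    case False
    then show ?thesis using rational_representation_coprime_3[OF m] by metis
  next
    case True
    then obtain m' where m': "m = 3 * m'" by blast
    have "\<not> 3 dvd m'"
    proof
      assume "3 dvd m'"
      then have "9 dvd n" unfolding n m' by auto
      then show False using assms(2) by simp
    qed
    moreover have "\<not> 3 dvd k"
    proof
      assume "3 dvd k"
      then have "9 dvd n" unfolding n by (auto simp: power_mult_distrib)
      then show False using assms(2) by simp
    qed
    then have "k\<^sup>2 mod 3 = 1"
    proof -
      have "k mod 3 = 1 \<or> k mod 3 = 2" using \<open>\<not> 3 dvd k\<close> by presburger
      moreover have "k\<^sup>2 mod 3 = (k mod 3)\<^sup>2 mod 3" by (simp add: power_mod)
      ultimately show ?thesis by auto
    qed
    then obtain j where j: "k\<^sup>2 = 3 * j + 1" by (metis mult_div_mod_eq)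
    have "n = 9 * (m' * j) + 3 * m'" unfolding n m' j by (simp add: algebra_simps)
    then have "3 * m' mod 9 \<noteq> 6" using assms(3) by presburger
    ultimately have "m' mod 3 = 1" by presburger
    moreover have "squarefree m'" using m m' squarefree_mono dvd_triv_right by metis
    ultimately show ?thesis using rational_representation_3_times[of m'] m' by metis
  qed
  then obtain t x y z where "t \<noteq> 0" "int m * t\<^sup>2 = x\<^sup>2 + y\<^sup>2 + 3 * (z::int)\<^sup>2" by blast
  then have "int m * t\<^sup>2 = hex_form x (y - z) (2 * z)"
    by (simp add: hex_form_def power2_eq_square algebra_simps)
  then obtain x u v where "int m = hex_form x u v" using davenport_cassels \<open>t \<noteq> 0\<close> by blast
  then obtain y z where "int m = x\<^sup>2 + y\<^sup>2 + 3 * z\<^sup>2" using hex_form_to_diagonal by metis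
  then have "int n = (int k * x)\<^sup>2 + (int k * y)\<^sup>2 + 3 * (int k * z)\<^sup>2"
    unfolding n by (simp add: power_mult_distrib algebra_simps)
  then show ?thesis by (rule that)
qed

text \<open>If 2 n = x^2 + y^2 + 3 z^2 with z even, then x and y have equal parity and n = ((x + y)
  / 2)^2 + ((x - y) / 2)^2 + 6 (z / 2)^2. Doubling sends the excluded residue 3 modulo 9 to
  6.\<close>

lemma represented_by_diag_1_1_6:
  assumes "n > 0" "\<not> 9 dvd n" "n mod 9 \<noteq> (3::nat)"
  obtains x y z :: int where "int n = x\<^sup>2 + y\<^sup>2 + 6 * z\<^sup>2"
proof -
  have "2 * n > 0" "\<not> 9 dvd 2 * n" "2 * n mod 9 \<noteq> 6" using assms by presburger+
  then obtain x y z :: int where xyz: "int (2 * n) = x\<^sup>2 + y\<^sup>2 + 3 * z\<^sup>2"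
    using represented_by_diag_1_1_3 by blast
  have "\<exists>x y z. int (2 * n) = x\<^sup>2 + y\<^sup>2 + 3 * (z::int)\<^sup>2 \<and> even z"
  proof (cases "even z")
    case False
    have step: "\<exists>x z'. u\<^sup>2 + 3 * z\<^sup>2 = x\<^sup>2 + 3 * z'\<^sup>2 \<and> even z'" if u: "odd u" for u
    proof -
      \<comment> \<open>\<open>4 (a\<^sup>2 + 3 b\<^sup>2) = (a - 3 b)\<^sup>2 + 3 (a + b)\<^sup>2\<close>, with the sign of \<open>z\<close> at our disposal\<close>
      have *: "\<exists>x z'. u\<^sup>2 + 3 * z\<^sup>2 = x\<^sup>2 + 3 * z'\<^sup>2 \<and> even z'" if "4 dvd u + w" "w\<^sup>2 = z\<^sup>2" for w
      proof -
        obtain k where "u + w = 4 * k" using \<open>4 dvd u + w\<close> by blast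
        then have u: "u = 4 * k - w" by simp
        have "u\<^sup>2 + 3 * z\<^sup>2 = (2 * k - 2 * w)\<^sup>2 + 3 * (2 * k)\<^sup>2"
          unfolding u \<open>w\<^sup>2 = z\<^sup>2\<close>[symmetric] by (simp add: power2_eq_square algebra_simps)
        then show ?thesis by (intro exI[of _ "2 * k - 2 * w"] exI[of _ "2 * k"]) simp
      qed
      have "4 dvd u + z \<or> 4 dvd u + - z" using u False by presburger
      then show ?thesis using *[of z] *[of "- z"] by auto
    qed
    have "odd x \<or> odd y"
    proof (rule ccontr)
      assume "\<not> ?thesis"
      then have "odd (int (2 * n))" unfolding xyz using False by simp
      then show False by simp
    qed
    then show ?thesis
    proof
      assume "odd x"
      then obtain x' z' where "x\<^sup>2 + 3 * z\<^sup>2 = x'\<^sup>2 + 3 * z'\<^sup>2" "even z'" using step by blast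
      then show ?thesis using xyz by (intro exI[of _ x'] exI[of _ y] exI[of _ z']) auto
    next
      assume "odd y"
      then obtain y' z' where "y\<^sup>2 + 3 * z\<^sup>2 = y'\<^sup>2 + 3 * z'\<^sup>2" "even z'" using step by blast
      then show ?thesis using xyz by (intro exI[of _ x] exI[of _ y'] exI[of _ z']) auto
    qed
  qed (use xyz in blast)
  then obtain x y z :: int where eq: "int (2 * n) = x\<^sup>2 + y\<^sup>2 + 3 * z\<^sup>2" "even z" by blast
  have "even (int (2 * n))" by simp
  then have "even (x + y)" unfolding eq(1) using eq(2) by simp
  then obtain s where s: "x + y = 2 * s" by blast
  obtain w where w: "z = 2 * w" using eq(2) by blast
  have y: "y = 2 * s - x" using s by simp
  have "2 * int n = x\<^sup>2 + y\<^sup>2 + 3 * z\<^sup>2" using eq(1) by simp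
  also have "\<dots> = 2 * (s\<^sup>2 + (x - s)\<^sup>2 + 6 * w\<^sup>2)"
    unfolding y w by (simp add: power2_eq_square algebra_simps)
  finally have "int n = s\<^sup>2 + (x - s)\<^sup>2 + 6 * w\<^sup>2" by simp
  then show ?thesis using that[of s "x - s" w] by simp
qed

subsection \<open>The six universal sums\<close>

lemma square_mod_3: "\<not> 3 dvd (w::int) \<Longrightarrow> w\<^sup>2 mod 3 = 1"
proof -
  assume "\<not> 3 dvd w"
  then have "w mod 3 = 1 \<or> w mod 3 = 2" by presburger
  moreover have "w\<^sup>2 mod 3 = (w mod 3)\<^sup>2 mod 3" by (simp add: power_mod)
  ultimately show ?thesis by auto
qed

lemma square_mod_3_dvd: "3 dvd (w::int) \<Longrightarrow> w\<^sup>2 mod 3 = 0"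
  by (auto simp: power2_eq_square)

text \<open>As y ranges over all integers, 3 y - 1 and its negative run through all integers prime
  to 3.\<close>

lemma octagonal_eq_square:
  assumes "\<not> 3 dvd (w::int)"
  obtains y where "w\<^sup>2 = 3 * (3 * y\<^sup>2 - 2 * y) + 1"
proof -
  have eq: "(3 * y - 1)\<^sup>2 = 3 * (3 * y\<^sup>2 - 2 * y) + 1" for y :: int
    by (simp add: power2_eq_square algebra_simps)
  have "3 dvd w + 1 \<or> 3 dvd 1 - w" using assms by presburger
  then obtain y where "w + 1 = 3 * y \<or> 1 - w = 3 * y" by blast
  then have "w = 3 * y - 1 \<or> w = - (3 * y - 1)" by linarith
  then have "w\<^sup>2 = (3 * y - 1)\<^sup>2" by (metis power2_minus)
  then show ?thesis using that eq by metis
qed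

lemma squares_sum_dvd_3:
  assumes "3 dvd (x\<^sup>2 + y\<^sup>2 :: int)"
  obtains a b where "x = 3 * a" "y = 3 * b"
proof -
  have "3 dvd x" "3 dvd y"
    using assms square_mod_3[of x] square_mod_3[of y] square_mod_3_dvd[of x] square_mod_3_dvd[of y]
    by (cases "3 dvd x"; cases "3 dvd y"; presburger)+
  then show ?thesis using that by blast
qed

lemma squares_sum_mod_3_eq_2:
  assumes "(x\<^sup>2 + y\<^sup>2) mod 3 = (2::int)"
  shows "\<not> 3 dvd x" "\<not> 3 dvd y"
  using assms square_mod_3[of x] square_mod_3[of y] square_mod_3_dvd[of x] square_mod_3_dvd[of y]
  by (cases "3 dvd x"; cases "3 dvd y"; presburger)+

lemma squares_sum_mod_3_eq_1:
  assumes "(x\<^sup>2 + y\<^sup>2) mod 3 = (1::int)"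
  obtains a w where "x\<^sup>2 + y\<^sup>2 = 9 * a\<^sup>2 + w\<^sup>2" "\<not> 3 dvd w"
proof -
  have "3 dvd x \<longleftrightarrow> \<not> 3 dvd y"
    using assms square_mod_3[of x] square_mod_3[of y] square_mod_3_dvd[of x] square_mod_3_dvd[of y]
    by (cases "3 dvd x"; cases "3 dvd y"; presburger)
  then consider a where "x = 3 * a" "\<not> 3 dvd y" | a where "y = 3 * a" "\<not> 3 dvd x" by blast
  then show ?thesis
  proof cases
    case 1
    then show ?thesis using that[of a y] by (simp add: power_mult_distrib)
  next
    case 2
    then show ?thesis using that[of a x] by (simp add: power_mult_distrib)
  qed
qed

lemma represented_by_diag_1_1_3_int:
  assumes "0 < M" "\<not> 9 dvd M" "M mod 9 \<noteq> (6::int)"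
  obtains x y z where "M = x\<^sup>2 + y\<^sup>2 + 3 * z\<^sup>2"
proof -
  obtain n where n: "M = int n" using assms(1) zero_less_imp_eq_int by blast
  have "n > 0" "\<not> 9 dvd n" "n mod 9 \<noteq> 6" using assms unfolding n by presburger+
  then show ?thesis using represented_by_diag_1_1_3 that n by metis
qed

lemma represented_by_diag_1_1_6_int:
  assumes "0 < M" "\<not> 9 dvd M" "M mod 9 \<noteq> (3::int)"
  obtains x y z where "M = x\<^sup>2 + y\<^sup>2 + 6 * z\<^sup>2"
proof -
  obtain n where n: "M = int n" using assms(1) zero_less_imp_eq_int by blast
  have "n > 0" "\<not> 9 dvd n" "n mod 9 \<noteq> 3" using assms unfolding n by presburger+
  then show ?thesis using represented_by_diag_1_1_6 that n by metis
qed

context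
  fixes N :: int
  assumes N: "0 \<le> N"
begin

text \<open>Divisibility of x^2 + y^2 by 3 forces x = 3 a and y = 3 b, so 9 N + 3 turns into 3 N + 1
  = 3 a^2 + 3 b^2 + z^2. The factors 1 match the shape of \<open>universal_2_1\<close>.\<close>

lemma universal_1_1_oct1: "\<exists>x y z. 1 * x\<^sup>2 + 1 * y\<^sup>2 + 1 * (3 * z\<^sup>2 - 2 * z) = N"
proof -
  have "0 < 9 * N + 3" "\<not> 9 dvd 9 * N + 3" "(9 * N + 3) mod 9 \<noteq> 6"
    using N by presburger+
  then obtain x y z where eq: "9 * N + 3 = x\<^sup>2 + y\<^sup>2 + 3 * z\<^sup>2" by (rule represented_by_diag_1_1_3_int)
  then have "3 dvd x\<^sup>2 + y\<^sup>2" by presburger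
  then obtain a b where ab: "x = 3 * a" "y = 3 * b" by (rule squares_sum_dvd_3)
  have eq': "z\<^sup>2 = 3 * (N - a\<^sup>2 - b\<^sup>2) + 1" using eq by (simp add: ab power_mult_distrib)
  then have "\<not> 3 dvd z" using square_mod_3_dvd[of z] by presburger
  then obtain w where "z\<^sup>2 = 3 * (3 * w\<^sup>2 - 2 * w) + 1" by (rule octagonal_eq_square)
  with eq' show ?thesis by (intro exI[of _ a] exI[of _ b] exI[of _ w]) simp
qed

lemma universal_1_1_oct2: "\<exists>x y z. 1 * x\<^sup>2 + 1 * y\<^sup>2 + 2 * (3 * z\<^sup>2 - 2 * z) = N"
proof -
  have "0 < 9 * N + 6" "\<not> 9 dvd 9 * N + 6" "(9 * N + 6) mod 9 \<noteq> 3"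
    using N by presburger+
  then obtain x y z where eq: "9 * N + 6 = x\<^sup>2 + y\<^sup>2 + 6 * z\<^sup>2" by (rule represented_by_diag_1_1_6_int)
  then have "3 dvd x\<^sup>2 + y\<^sup>2" by presburger
  then obtain a b where ab: "x = 3 * a" "y = 3 * b" by (rule squares_sum_dvd_3)
  have eq': "2 * z\<^sup>2 = 3 * (N - a\<^sup>2 - b\<^sup>2) + 2" using eq by (simp add: ab power_mult_distrib)
  then have "\<not> 3 dvd z" using square_mod_3_dvd[of z] by presburger
  then obtain w where "z\<^sup>2 = 3 * (3 * w\<^sup>2 - 2 * w) + 1" by (rule octagonal_eq_square)
  with eq' show ?thesis by (intro exI[of _ a] exI[of _ b] exI[of _ w]) simp
qed

text \<open>Since x^2 + y^2 is 1 modulo 3, exactly one of x, y is a multiple 3 a of 3. It supplies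
  the term 3 a^2, and the other one the octagonal number.\<close>

lemma universal_1_3_oct1: "\<exists>x y z. 1 * x\<^sup>2 + 3 * y\<^sup>2 + 1 * (3 * z\<^sup>2 - 2 * z) = N"
proof -
  have "0 < 3 * N + 1" "\<not> 9 dvd 3 * N + 1" "(3 * N + 1) mod 9 \<noteq> 6"
    using N by presburger+
  then obtain x y z where eq: "3 * N + 1 = x\<^sup>2 + y\<^sup>2 + 3 * z\<^sup>2" by (rule represented_by_diag_1_1_3_int)
  then have "(x\<^sup>2 + y\<^sup>2) mod 3 = 1" by presburger
  then obtain a w where aw: "x\<^sup>2 + y\<^sup>2 = 9 * a\<^sup>2 + w\<^sup>2" "\<not> 3 dvd w" by (rule squares_sum_mod_3_eq_1)
  from aw(2) obtain v where "w\<^sup>2 = 3 * (3 * v\<^sup>2 - 2 * v) + 1" by (rule octagonal_eq_square)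
  with eq aw(1) show ?thesis by (intro exI[of _ z] exI[of _ a] exI[of _ v]) simp
qed

lemma universal_2_3_oct1: "\<exists>x y z. 2 * x\<^sup>2 + 3 * y\<^sup>2 + 1 * (3 * z\<^sup>2 - 2 * z) = N"
proof -
  have "0 < 3 * N + 1" "\<not> 9 dvd 3 * N + 1" "(3 * N + 1) mod 9 \<noteq> 3"
    using N by presburger+
  then obtain x y z where eq: "3 * N + 1 = x\<^sup>2 + y\<^sup>2 + 6 * z\<^sup>2" by (rule represented_by_diag_1_1_6_int)
  then have "(x\<^sup>2 + y\<^sup>2) mod 3 = 1" by presburger
  then obtain a w where aw: "x\<^sup>2 + y\<^sup>2 = 9 * a\<^sup>2 + w\<^sup>2" "\<not> 3 dvd w" by (rule squares_sum_mod_3_eq_1)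
  from aw(2) obtain v where "w\<^sup>2 = 3 * (3 * v\<^sup>2 - 2 * v) + 1" by (rule octagonal_eq_square)
  with eq aw(1) show ?thesis by (intro exI[of _ z] exI[of _ a] exI[of _ v]) simp
qed

text \<open>Now x and y are both prime to 3, and each yields an octagonal number.\<close>

lemma universal_1_oct1_oct1: "\<exists>x y z. 1 * x\<^sup>2 + 1 * (3 * y\<^sup>2 - 2 * y) + 1 * (3 * z\<^sup>2 - 2 * z) = N"
proof -
  have "0 < 3 * N + 2" "\<not> 9 dvd 3 * N + 2" "(3 * N + 2) mod 9 \<noteq> 6"
    using N by presburger+
  then obtain x y z where eq: "3 * N + 2 = x\<^sup>2 + y\<^sup>2 + 3 * z\<^sup>2" by (rule represented_by_diag_1_1_3_int)
  then have "(x\<^sup>2 + y\<^sup>2) mod 3 = 2" by presburger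
  then have "\<not> 3 dvd x" "\<not> 3 dvd y" by (rule squares_sum_mod_3_eq_2)+
  then obtain u v where "x\<^sup>2 = 3 * (3 * u\<^sup>2 - 2 * u) + 1" "y\<^sup>2 = 3 * (3 * v\<^sup>2 - 2 * v) + 1"
    using octagonal_eq_square by metis
  with eq show ?thesis by (intro exI[of _ z] exI[of _ u] exI[of _ v]) simp
qed

lemma universal_2_oct1_oct1: "\<exists>x y z. 2 * x\<^sup>2 + 1 * (3 * y\<^sup>2 - 2 * y) + 1 * (3 * z\<^sup>2 - 2 * z) = N"
proof -
  have "0 < 3 * N + 2" "\<not> 9 dvd 3 * N + 2" "(3 * N + 2) mod 9 \<noteq> 3"
    using N by presburger+
  then obtain x y z where eq: "3 * N + 2 = x\<^sup>2 + y\<^sup>2 + 6 * z\<^sup>2" by (rule represented_by_diag_1_1_6_int)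
  then have "(x\<^sup>2 + y\<^sup>2) mod 3 = 2" by presburger
  then have "\<not> 3 dvd x" "\<not> 3 dvd y" by (rule squares_sum_mod_3_eq_2)+
  then obtain u v where "x\<^sup>2 = 3 * (3 * u\<^sup>2 - 2 * u) + 1" "y\<^sup>2 = 3 * (3 * v\<^sup>2 - 2 * v) + 1"
    using octagonal_eq_square by metis
  with eq show ?thesis by (intro exI[of _ z] exI[of _ u] exI[of _ v]) simp
qed

end

subsection \<open>Necessity\<close>

text \<open>This list and the next hold all values up to 18; the next square is 25 and the next
  octagonal number 21.\<close>

definition small_squares :: "int list" where "small_squares = [0, 1, 4, 9, 16]"

definition small_octagonals :: "int list" where "small_octagonals = [0, 1, 5, 8, 16]"

lemma abs_le_4: "x\<^sup>2 \<le> 18 \<Longrightarrow> \<bar>x::int\<bar> \<le> 4"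
proof (rule ccontr)
  assume "x\<^sup>2 \<le> 18" "\<not> \<bar>x\<bar> \<le> 4"
  then have "5\<^sup>2 \<le> \<bar>x\<bar>\<^sup>2" by (intro power_mono) auto
  with \<open>x\<^sup>2 \<le> 18\<close> show False by simp
qed

lemma small_square:
  assumes "x\<^sup>2 \<le> 18"
  shows "x\<^sup>2 \<in> set small_squares"
proof -
  have "x \<in> {-4, -3, -2, -1, 0, 1, 2, 3, 4}" using abs_le_4[OF assms] by auto
  then show ?thesis by (auto simp: small_squares_def)
qed

lemma octagonal_ge_square: "y\<^sup>2 \<le> 3 * y\<^sup>2 - 2 * (y::int)"
proof -
  have "0 \<le> y * (y - 1)" by (cases "1 \<le> y") (auto simp: zero_le_mult_iff)
  then show ?thesis by (simp add: power2_eq_square algebra_simps)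
qed

lemma small_octagonal:
  assumes "3 * y\<^sup>2 - 2 * y \<le> 18"
  shows "3 * y\<^sup>2 - 2 * y \<in> set small_octagonals"
proof -
  have "\<bar>y\<bar> \<le> 4" using assms octagonal_ge_square[of y] by (intro abs_le_4) linarith
  then have "y \<in> {-4, -3, -2, -1, 0, 1, 2, 3, 4}" by auto
  then show ?thesis using assms by (auto simp: small_octagonals_def)
qed

definition represents_upto_18 :: "int list \<Rightarrow> int list \<Rightarrow> int list \<Rightarrow> int \<Rightarrow> int \<Rightarrow> int \<Rightarrow> bool" where
  "represents_upto_18 K1 K2 K3 a b c \<longleftrightarrow>
    (\<forall>N\<in>set [1..18]. \<exists>s\<in>set K1. \<exists>t\<in>set K2. \<exists>u\<in>set K3. a * s + b * t + c * u = N)"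

lemma represents_upto_18_rotate:
  "represents_upto_18 K1 K2 K3 a b c \<Longrightarrow> represents_upto_18 K2 K3 K1 b c a"
  unfolding represents_upto_18_def by (metis add.assoc add.commute)

text \<open>Neither list has an entry strictly between 1 and 4, so representing 2 forces b to be 1
  or 2. For b = 1 the number 3 is missed; for b = 2 it is 5 if \<open>K1\<close> holds the squares
  and 4 otherwise.\<close>

lemma binary_not_represents_upto_5:
  assumes K: "K1 \<in> {small_squares, small_octagonals}" "K2 \<in> {small_squares, small_octagonals}"
    and "b > 0" and rep: "\<And>N. N \<in> {1..5} \<Longrightarrow> \<exists>s\<in>set K1. \<exists>t\<in>set K2. s + b * t = N"
  shows False
proof -
  obtain s t where st: "s \<in> set K1" "t \<in> set K2" "s + b * t = 2" using rep[of 2] by auto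
  have "t = 0 \<or> t = 1 \<or> 4 \<le> t" using st(2) K(2) by (auto simp: small_squares_def small_octagonals_def)
  moreover have "4 * b \<le> b * t" if "4 \<le> t" using that \<open>b > 0\<close> by simp
  moreover have "s = 0 \<or> s = 1 \<or> 4 \<le> s" using st(1) K(1) by (auto simp: small_squares_def small_octagonals_def)
  ultimately have "b = 1 \<or> b = 2" using st(3) \<open>b > 0\<close> by fastforce
  then show False
  proof
    assume "b = 1"
    with rep[of 3] K show False by (auto simp: small_squares_def small_octagonals_def)
  next
    assume "b = 2"
    with rep[of 5] rep[of 4] K show False
      by (elim insertE emptyE) (simp_all add: small_squares_def small_octagonals_def)
  qed
qed

text \<open>If c exceeds 5, the other two terms alone represent 1, ..., 5. Representing 1 makes one
  of their coefficients 1, the case already excluded.\<close>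

lemma third_coefficient_le_5:
  assumes K: "K1 \<in> {small_squares, small_octagonals}" "K2 \<in> {small_squares, small_octagonals}"
      "K3 \<in> {small_squares, small_octagonals}"
    and pos: "a > 0" "b > 0" "c > 0" and rep: "represents_upto_18 K1 K2 K3 a b c"
  shows "c \<le> 5"
proof (rule ccontr)
  assume "\<not> c \<le> 5"
  have nonneg: "0 \<le> s" if "s \<in> set K" "K \<in> {small_squares, small_octagonals}" for s K
    using that by (auto simp: small_squares_def small_octagonals_def)
  have binary: "\<exists>s\<in>set K1. \<exists>t\<in>set K2. a * s + b * t = N" if N: "N \<in> {1..5}" for N
  proof -
    obtain s t u where stu: "s \<in> set K1" "t \<in> set K2" "u \<in> set K3" "a * s + b * t + c * u = N"
      using rep N unfolding represents_upto_18_def by force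
    have "0 \<le> a * s" "0 \<le> b * t" using stu nonneg K pos by simp_all
    then have "c * u \<le> 5" using stu(4) N by simp
    have "u < 1"
    proof (rule ccontr)
      assume "\<not> u < 1"
      then have "c * 1 \<le> c * u" using pos(3) by (intro mult_left_mono) auto
      then show False using \<open>c * u \<le> 5\<close> \<open>\<not> c \<le> 5\<close> by linarith
    qed
    then have "u = 0" using nonneg[OF stu(3) K(3)] by simp
    then show ?thesis using stu by auto
  qed
  obtain s t where st: "s \<in> set K1" "t \<in> set K2" "a * s + b * t = 1" using binary[of 1] by auto
  have "0 \<le> a * s" "0 \<le> b * t" using st nonneg K pos by simp_all
  then have "a * s = 1 \<or> b * t = 1" using st(3) by linarith
  then have "a = 1 \<or> b = 1" using pos by (auto simp: zmult_eq_1_iff)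
  then show False
    using binary_not_represents_upto_5[OF K(1,2) pos(2)] binary_not_represents_upto_5[OF K(2,1) pos(1)]
      binary by (metis add.commute mult_1)
qed

text \<open>The hypotheses survive rotating the coefficients together with their lists, so the bound
  on the last coefficient applies to all three.\<close>

lemma coefficients_le_5:
  assumes K: "K1 \<in> {small_squares, small_octagonals}" "K2 \<in> {small_squares, small_octagonals}"
      "K3 \<in> {small_squares, small_octagonals}"
    and pos: "a > 0" "b > 0" "c > 0" and rep: "represents_upto_18 K1 K2 K3 a b c"
  shows "a \<in> set [1..5]" "b \<in> set [1..5]" "c \<in> set [1..5]"
  using third_coefficient_le_5[OF K pos rep]
    third_coefficient_le_5[OF K(2,3,1) pos(2,3,1) represents_upto_18_rotate[OF rep]]
    third_coefficient_le_5[OF K(3,1,2) pos(3,1,2) represents_upto_18_rotate[OF represents_upto_18_rotate[OF rep]]]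
    pos by auto

text \<open>Evaluation over the 125 triples for each shape. Both orders of two different square
  coefficients are listed, as no order is imposed on them.\<close>

lemma bounded_search:
  "\<forall>a\<in>set [1..5]. \<forall>b\<in>set [1..5]. \<forall>c\<in>set [1..5].
    \<not> represents_upto_18 small_squares small_squares small_squares a b c"
  "\<forall>a\<in>set [1..5]. \<forall>b\<in>set [1..5]. \<forall>c\<in>set [1..5].
    represents_upto_18 small_squares small_squares small_octagonals a b c \<longrightarrow>
    (a, b, c) \<in> set [(1, 1, 1), (1, 1, 2), (1, 3, 1), (3, 1, 1), (2, 3, 1), (3, 2, 1)]"
  "\<forall>a\<in>set [1..5]. \<forall>b\<in>set [1..5]. \<forall>c\<in>set [1..5].
    represents_upto_18 small_squares small_octagonals small_octagonals a b c \<longrightarrow>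
    (a, b, c) \<in> set [(1, 1, 1), (2, 1, 1)]"
  "\<forall>a\<in>set [1..5]. \<forall>b\<in>set [1..5]. \<forall>c\<in>set [1..5].
    \<not> represents_upto_18 small_octagonals small_octagonals small_octagonals a b c"
  by code_simp+

text \<open>With coefficients at least 1 and nonnegative values, each value occurring in a
  representation of N <= 18 is itself at most 18 and so lies in its list.\<close>

lemma represents_upto_18I:
  assumes pos: "a > 0" "b > 0" "c > 0"
    and small: "\<And>x. f x \<le> 18 \<Longrightarrow> f x \<in> set K1" "\<And>y. g y \<le> 18 \<Longrightarrow> g y \<in> set K2" "\<And>z. h z \<le> 18 \<Longrightarrow> h z \<in> set K3"
    and nonneg: "\<And>x. 0 \<le> f x" "\<And>y. 0 \<le> g y" "\<And>z. 0 \<le> h z"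
    and rep: "\<And>N. 0 \<le> N \<Longrightarrow> \<exists>x y z. a * f x + b * g y + c * h z = N"
  shows "represents_upto_18 K1 K2 K3 a b c"
  unfolding represents_upto_18_def
proof
  fix N :: int assume "N \<in> set [1..18]"
  then have N: "0 \<le> N" "N \<le> 18" by auto
  obtain x y z where eq: "a * f x + b * g y + c * h z = N" using rep[OF N(1)] by blast
  have "f x \<le> a * f x" "g y \<le> b * g y" "h z \<le> c * h z"
    using pos nonneg mult_right_mono[of 1 _ "f x"] mult_right_mono[of 1 _ "g y"] mult_right_mono[of 1 _ "h z"]
    by auto
  then have "f x \<le> 18" "g y \<le> 18" "h z \<le> 18"
    using eq N nonneg(1)[of x] nonneg(2)[of y] nonneg(3)[of z] by linarith+
  then show "\<exists>s\<in>set K1. \<exists>t\<in>set K2. \<exists>u\<in>set K3. a * s + b * t + c * u = N"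
    using small eq by blast
qed

lemma octagonal_nonneg: "0 \<le> 3 * y\<^sup>2 - 2 * (y::int)"
  using octagonal_ge_square[of y] zero_le_power2[of y] by linarith

section \<open>The four shapes of coefficient lists\<close>

lemma universal_3_0:
  "universal [a, b, c] [] \<longleftrightarrow> (\<forall>N\<ge>0. \<exists>x y z. a * x\<^sup>2 + b * y\<^sup>2 + c * z\<^sup>2 = N)"
proof -
  have eq: "mixed_sum [a, b, c] [] x y = a * (x ! 0)\<^sup>2 + b * (x ! 1)\<^sup>2 + c * (x ! 2)\<^sup>2" for x y
    by (simp add: mixed_sum_def gen_polygonal_4 gen_polygonal_8 lessThan_Suc numeral_2_eq_2)
  show ?thesis
    unfolding universal_def eq
  proof (intro iffI allI impI)
    fix N :: int
    assume "\<forall>N\<ge>0. \<exists>x y z. a * x\<^sup>2 + b * y\<^sup>2 + c * z\<^sup>2 = N" "0 \<le> N"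
    then obtain x y z where "a * x\<^sup>2 + b * y\<^sup>2 + c * z\<^sup>2 = N" by blast
    then show "\<exists>x y. length x = length [a, b, c] \<and> length y = length [] \<and> a * (x ! 0)\<^sup>2 + b * (x ! 1)\<^sup>2 + c * (x ! 2)\<^sup>2 = N"
      by (intro exI[of _ "[x, y, z]"] exI[of _ "[]"]) simp
  qed blast
qed

lemma universal_2_1:
  "universal [a, b] [c] \<longleftrightarrow> (\<forall>N\<ge>0. \<exists>x y z. a * x\<^sup>2 + b * y\<^sup>2 + c * (3 * z\<^sup>2 - 2 * z) = N)"
proof -
  have eq: "mixed_sum [a, b] [c] x y = a * (x ! 0)\<^sup>2 + b * (x ! 1)\<^sup>2 + c * (3 * (y ! 0)\<^sup>2 - 2 * (y ! 0))" for x y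
    by (simp add: mixed_sum_def gen_polygonal_4 gen_polygonal_8 lessThan_Suc numeral_2_eq_2)
  show ?thesis
    unfolding universal_def eq
  proof (intro iffI allI impI)
    fix N :: int
    assume "\<forall>N\<ge>0. \<exists>x y z. a * x\<^sup>2 + b * y\<^sup>2 + c * (3 * z\<^sup>2 - 2 * z) = N" "0 \<le> N"
    then obtain x y z where "a * x\<^sup>2 + b * y\<^sup>2 + c * (3 * z\<^sup>2 - 2 * z) = N" by blast
    then show "\<exists>x y. length x = length [a, b] \<and> length y = length [c] \<and> a * (x ! 0)\<^sup>2 + b * (x ! 1)\<^sup>2 + c * (3 * (y ! 0)\<^sup>2 - 2 * (y ! 0)) = N"
      by (intro exI[of _ "[x, y]"] exI[of _ "[z]"]) simp
  qed blast
qed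

lemma universal_1_2:
  "universal [a] [b, c] \<longleftrightarrow> (\<forall>N\<ge>0. \<exists>x y z. a * x\<^sup>2 + b * (3 * y\<^sup>2 - 2 * y) + c * (3 * z\<^sup>2 - 2 * z) = N)"
proof -
  have eq: "mixed_sum [a] [b, c] x y = a * (x ! 0)\<^sup>2 + b * (3 * (y ! 0)\<^sup>2 - 2 * (y ! 0)) + c * (3 * (y ! 1)\<^sup>2 - 2 * (y ! 1))" for x y
    by (simp add: mixed_sum_def gen_polygonal_4 gen_polygonal_8 lessThan_Suc numeral_2_eq_2)
  show ?thesis
    unfolding universal_def eq
  proof (intro iffI allI impI)
    fix N :: int
    assume "\<forall>N\<ge>0. \<exists>x y z. a * x\<^sup>2 + b * (3 * y\<^sup>2 - 2 * y) + c * (3 * z\<^sup>2 - 2 * z) = N" "0 \<le> N"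
    then obtain x y z where "a * x\<^sup>2 + b * (3 * y\<^sup>2 - 2 * y) + c * (3 * z\<^sup>2 - 2 * z) = N" by blast
    then show "\<exists>x y. length x = length [a] \<and> length y = length [b, c] \<and> a * (x ! 0)\<^sup>2 + b * (3 * (y ! 0)\<^sup>2 - 2 * (y ! 0)) + c * (3 * (y ! 1)\<^sup>2 - 2 * (y ! 1)) = N"
      by (intro exI[of _ "[x]"] exI[of _ "[y, z]"]) simp
  qed blast
qed

lemma universal_0_3:
  "universal [] [a, b, c] \<longleftrightarrow> (\<forall>N\<ge>0. \<exists>x y z. a * (3 * x\<^sup>2 - 2 * x) + b * (3 * y\<^sup>2 - 2 * y) + c * (3 * z\<^sup>2 - 2 * z) = N)"
proof -
  have eq: "mixed_sum [] [a, b, c] x y = a * (3 * (y ! 0)\<^sup>2 - 2 * (y ! 0)) + b * (3 * (y ! 1)\<^sup>2 - 2 * (y ! 1)) + c * (3 * (y ! 2)\<^sup>2 - 2 * (y ! 2))" for x y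
    by (simp add: mixed_sum_def gen_polygonal_4 gen_polygonal_8 lessThan_Suc numeral_2_eq_2)
  show ?thesis
    unfolding universal_def eq
  proof (intro iffI allI impI)
    fix N :: int
    assume "\<forall>N\<ge>0. \<exists>x y z. a * (3 * x\<^sup>2 - 2 * x) + b * (3 * y\<^sup>2 - 2 * y) + c * (3 * z\<^sup>2 - 2 * z) = N" "0 \<le> N"
    then obtain x y z where "a * (3 * x\<^sup>2 - 2 * x) + b * (3 * y\<^sup>2 - 2 * y) + c * (3 * z\<^sup>2 - 2 * z) = N" by blast
    then show "\<exists>x y. length x = length [] \<and> length y = length [a, b, c] \<and> a * (3 * (y ! 0)\<^sup>2 - 2 * (y ! 0)) + b * (3 * (y ! 1)\<^sup>2 - 2 * (y ! 1)) + c * (3 * (y ! 2)\<^sup>2 - 2 * (y ! 2)) = N"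
      by (intro exI[of _ "[]"] exI[of _ "[x, y, z]"]) simp
  qed blast
qed

lemma represents_upto_18_if_universal:
  assumes "a > 0" "b > 0" "c > 0"
  shows "universal [a, b, c] [] \<Longrightarrow> represents_upto_18 small_squares small_squares small_squares a b c"
    and "universal [a, b] [c] \<Longrightarrow> represents_upto_18 small_squares small_squares small_octagonals a b c"
    and "universal [a] [b, c] \<Longrightarrow> represents_upto_18 small_squares small_octagonals small_octagonals a b c"
    and "universal [] [a, b, c] \<Longrightarrow> represents_upto_18 small_octagonals small_octagonals small_octagonals a b c"
proof -
  show "represents_upto_18 small_squares small_squares small_squares a b c"
    if "universal [a, b, c] []"
    using that unfolding universal_3_0
    by (intro represents_upto_18I[OF assms, where f = "\<lambda>x. x\<^sup>2"
          and g = "\<lambda>x. x\<^sup>2" and h = "\<lambda>x. x\<^sup>2"])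
      (erule small_square small_octagonal | rule zero_le_power2 octagonal_nonneg | blast)+
  show "represents_upto_18 small_squares small_squares small_octagonals a b c"
    if "universal [a, b] [c]"
    using that unfolding universal_2_1
    by (intro represents_upto_18I[OF assms, where f = "\<lambda>x. x\<^sup>2"
          and g = "\<lambda>x. x\<^sup>2" and h = "\<lambda>x. 3 * x\<^sup>2 - 2 * x"])
      (erule small_square small_octagonal | rule zero_le_power2 octagonal_nonneg | blast)+
  show "represents_upto_18 small_squares small_octagonals small_octagonals a b c"
    if "universal [a] [b, c]"
    using that unfolding universal_1_2
    by (intro represents_upto_18I[OF assms, where f = "\<lambda>x. x\<^sup>2"
          and g = "\<lambda>x. 3 * x\<^sup>2 - 2 * x" and h = "\<lambda>x. 3 * x\<^sup>2 - 2 * x"])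
      (erule small_square small_octagonal | rule zero_le_power2 octagonal_nonneg | blast)+
  show "represents_upto_18 small_octagonals small_octagonals small_octagonals a b c"
    if "universal [] [a, b, c]"
    using that unfolding universal_0_3
    by (intro represents_upto_18I[OF assms, where f = "\<lambda>x. 3 * x\<^sup>2 - 2 * x"
          and g = "\<lambda>x. 3 * x\<^sup>2 - 2 * x" and h = "\<lambda>x. 3 * x\<^sup>2 - 2 * x"])
      (erule small_square small_octagonal | rule zero_le_power2 octagonal_nonneg | blast)+
qed

lemma universal_ternary_necessary:
  assumes "a > 0" "b > 0" "c > 0"
  shows "\<not> universal [a, b, c] []"
    and "universal [a, b] [c] \<Longrightarrow>
      (a, b, c) \<in> set [(1, 1, 1), (1, 1, 2), (1, 3, 1), (3, 1, 1), (2, 3, 1), (3, 2, 1)]"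
    and "universal [a] [b, c] \<Longrightarrow> (a, b, c) \<in> set [(1, 1, 1), (2, 1, 1)]"
    and "\<not> universal [] [a, b, c]"
proof -
  have small: "small_squares \<in> {small_squares, small_octagonals}"
    "small_octagonals \<in> {small_squares, small_octagonals}" by simp_all
  note bounds = coefficients_le_5[OF _ _ _ assms]
  show "\<not> universal [a, b, c] []"
    using bounded_search(1) bounds[OF small(1,1,1)] represents_upto_18_if_universal(1)[OF assms] by blast
  show "(a, b, c) \<in> set [(1, 1, 1), (1, 1, 2), (1, 3, 1), (3, 1, 1), (2, 3, 1), (3, 2, 1)]"
    if "universal [a, b] [c]"
    using bounded_search(2) bounds[OF small(1,1,2)] represents_upto_18_if_universal(2)[OF assms that] by blast
  show "(a, b, c) \<in> set [(1, 1, 1), (2, 1, 1)]" if "universal [a] [b, c]"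
    using bounded_search(3) bounds[OF small(1,2,2)] represents_upto_18_if_universal(3)[OF assms that] by blast
  show "\<not> universal [] [a, b, c]"
    using bounded_search(4) bounds[OF small(2,2,2)] represents_upto_18_if_universal(4)[OF assms] by blast
qed

lemma universal_swap: "universal [a, b] [c] \<Longrightarrow> universal [b, a] [c]"
  unfolding universal_2_1 by (metis add.commute)

lemma universal_ternary_sufficient:
  "universal [1, 1] [1]" "universal [1, 1] [2]" "universal [1, 3] [1]" "universal [3, 1] [1]"
  "universal [2, 3] [1]" "universal [3, 2] [1]" "universal [1] [1, 1]" "universal [2] [1, 1]"
proof -
  show u13: "universal [1, 3] [1]" and u23: "universal [2, 3] [1]"
    unfolding universal_2_1 using universal_1_3_oct1 universal_2_3_oct1 by blast+
  show "universal [1, 1] [1]" "universal [1, 1] [2]"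
    unfolding universal_2_1 using universal_1_1_oct1 universal_1_1_oct2 by blast+
  show "universal [3, 1] [1]" "universal [3, 2] [1]"
    using u13 u23 by (auto intro: universal_swap)
  show "universal [1] [1, 1]" "universal [2] [1, 1]"
    unfolding universal_1_2 using universal_1_oct1_oct1 universal_2_oct1_oct1 by blast+
qed

section \<open>The classification up to reordering\<close>

lemma mset_eq_pair_iff: "mset xs = {#x, y#} \<longleftrightarrow> xs = [x, y] \<or> xs = [y, x]"
proof
  assume eq: "mset xs = {#x, y#}"
  then have "length xs = 2" by (metis size_mset size_add_mset size_single Suc_1)
  then obtain u v where "xs = [u, v]" by (auto simp: numeral_2_eq_2 length_Suc_conv)
  then show "xs = [x, y] \<or> xs = [y, x]" using eq by (auto simp: add_eq_conv_ex)
qed (auto simp: add_mset_commute)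

lemma universal_iff_mset:
  assumes "ternary_coeffs \<alpha> \<beta>"
  shows "universal \<alpha> \<beta> \<longleftrightarrow>
    (mset \<alpha>, mset \<beta>) \<in>
      {({#1, 1#}, {#1#}), ({#1, 1#}, {#2#}), ({#1, 3#}, {#1#}),
       ({#1#}, {#1, 1#}), ({#2, 3#}, {#1#}), ({#2#}, {#1, 1#})}" (is "_ \<longleftrightarrow> _ \<in> ?S")
proof
  assume "(mset \<alpha>, mset \<beta>) \<in> ?S"
  then show "universal \<alpha> \<beta>"
    using universal_ternary_sufficient by (auto simp: mset_eq_pair_iff)
next
  assume univ: "universal \<alpha> \<beta>"
  have pos: "\<forall>a\<in>set \<alpha>. 0 < a" "\<forall>b\<in>set \<beta>. 0 < b" and len: "length \<alpha> + length \<beta> = 3"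
    using assms by (auto simp: ternary_coeffs_def)
  have "length \<alpha> = 3 \<and> length \<beta> = 0 \<or> length \<alpha> = 2 \<and> length \<beta> = 1
      \<or> length \<alpha> = 1 \<and> length \<beta> = 2 \<or> length \<alpha> = 0 \<and> length \<beta> = 3"
    using len by linarith
  then consider a b c where "\<alpha> = [a, b, c]" "\<beta> = []" | a b c where "\<alpha> = [a, b]" "\<beta> = [c]"
    | a b c where "\<alpha> = [a]" "\<beta> = [b, c]" | a b c where "\<alpha> = []" "\<beta> = [a, b, c]"
    by (auto simp: length_Suc_conv numeral_eq_Suc)
  then show "(mset \<alpha>, mset \<beta>) \<in> ?S"
  proof cases
    case 1
    then show ?thesis using univ pos universal_ternary_necessary(1) by auto
  next
    case 2
    then have "(a, b, c) \<in> set [(1, 1, 1), (1, 1, 2), (1, 3, 1), (3, 1, 1), (2, 3, 1), (3, 2, 1)]"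
      using univ pos by (intro universal_ternary_necessary(2)) auto
    then show ?thesis using 2 by (auto simp: add_mset_commute)
  next
    case 3
    then have "(a, b, c) \<in> set [(1, 1, 1), (2, 1, 1)]"
      using univ pos by (intro universal_ternary_necessary(3)) auto
    then show ?thesis using 3 by auto
  next
    case 4
    then show ?thesis using univ pos universal_ternary_necessary(4) by auto
  qed
qed

theorem theorem3p1:
  shows "(\<forall>\<alpha> \<beta>. ternary_coeffs \<alpha> \<beta> \<longrightarrow>
           (universal \<alpha> \<beta> \<longleftrightarrow>
             (mset \<alpha>, mset \<beta>) \<in>
               {({#1, 1#}, {#1#}), ({#1, 1#}, {#2#}), ({#1, 3#}, {#1#}),
                ({#1#}, {#1, 1#}), ({#2, 3#}, {#1#}), ({#2#}, {#1, 1#})})) \<and>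
         card {(mset \<alpha>, mset \<beta>) | \<alpha> \<beta>. ternary_coeffs \<alpha> \<beta> \<and> universal \<alpha> \<beta>} = 6"
    (is "_ \<and> card ?U = 6")
proof
  let ?S = "{({#1, 1#}, {#1#}), ({#1, 1#}, {#2#}), ({#1, 3#}, {#1#}),
    ({#1#}, {#1, 1#}), ({#2, 3#}, {#1#}), ({#2#}, {#1, 1#})} :: (int multiset \<times> int multiset) set"
  have "?U = ?S"
  proof (intro equalityI subsetI)
    fix x assume "x \<in> ?U"
    then obtain \<alpha> \<beta> where "x = (mset \<alpha>, mset \<beta>)" "ternary_coeffs \<alpha> \<beta>" "universal \<alpha> \<beta>" by blast
    then show "x \<in> ?S" using universal_iff_mset by simp
  next
    \<comment> \<open>The eight ordered pairs of coefficient lists shown to be universal cover all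
      six pairs of multisets.\<close>
    have member: "(mset \<alpha>, mset \<beta>) \<in> ?U" if "universal \<alpha> \<beta>" "ternary_coeffs \<alpha> \<beta>" for \<alpha> \<beta>
      using that by blast
    fix x assume "x \<in> ?S"
    then show "x \<in> ?U"
      using universal_ternary_sufficient[THEN member] by (auto simp: ternary_coeffs_def simp del: mem_Collect_eq)
  qed
  moreover have "card ?S = 6" by (simp add: add_eq_conv_ex)
  ultimately show "card ?U = 6" by simp
qed (use universal_iff_mset in blast)

end
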